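(* Let $p$ be an $r$-bit prime, let $g$ be an integer with $p\nmid g$, let $u_0\in\{1,\ldots,p-1\}$, and let $k$ be an integer with $1\le k\le r$. Let $\ell$ be the trajectory length of the sequence $\{u_n\}$, and let $\nu_k(N)$ be the number of distinct values among $\xi^{(k)}_n$, $n=0,\ldots,N-1$. Then for all positive integers $N\le \ell$, $$ \nu_k(N) \ge N^{o(1)}\cdot \left\{\begin{array}{ll} N^{6/11}(2^k/p)^{1/2}, & \text{if } N \le p^{1/2},\\ N^{7/12}2^{k/2} p^{-13/24}, & \text{if } p^{1/2} < N \le p^{35/68},\\ N^{5/11}2^{k/2} p^{-9/22}, & \text{if } p^{35/68} < N \le p^{13/24},\\ N 2^{k/2} p^{-1}, & \text{if } p^{13/24} < N \le p^{2/3},\\ N^{1/4}2^{k/2}p^{-1/4}, & \text{if } N > p^{2/3}. \end{array}\right. $$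
   Context: An $r$-bit prime is a prime $p$ with $2^{r-1}\le p<2^r$. Given a prime $p$, an integer $g$ with $p\nmid g$ and $u_0\in\{1,\ldots,p-1\}$, the sequence $\{u_n\}_{n\ge 0}$ is defined recursively by $u_n\equiv g^{u_{n-1}} \pmod p$, $1\le u_n\le p-1$, for $n=1,2,\ldots$ (the exponent $u_{n-1}$ is taken as an integer). It is eventually periodic: let $t\ge 1$ and then $s\ge 0$ be the smallest possible integers such that $u_n=u_{n+t}$ for all $n\ge s$. The trajectory length is $\ell=s+t$. For an integer $k\ge1$, $\xi^{(k)}_n\in\{0,\ldots,2^k-1\}$ denotes the integer formed by the $k$ least significant bits of $u_n$ (that is, $u_n$ reduced modulo $2^k$). The notation $N^{o(1)}$ is understood as $N\to\infty$, uniformly in $p$, $g$, $u_0$ and $k$: for every $\varepsilon>0$ there is $N_0(\varepsilon)$ such that for all $N\ge N_0(\varepsilon)$ (with $N\le\ell$) the inequality holds with $N^{o(1)}$ replaced by $N^{-\varepsilon}$. *)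

theory Defs
  imports Complex_Main "HOL-Computational_Algebra.Primes" "HOL-Number_Theory.Cong"
begin

definition bit_prime :: "nat \<Rightarrow> nat \<Rightarrow> bool" where
  "bit_prime r p \<longleftrightarrow> prime p \<and> 2 ^ (r - 1) \<le> p \<and> p < 2 ^ r"

definition exp_seq :: "nat \<Rightarrow> int \<Rightarrow> nat \<Rightarrow> (nat \<Rightarrow> nat) \<Rightarrow> bool" where
  "exp_seq p g u0 u \<longleftrightarrow>
     u 0 = u0 \<and>
     (\<forall>n. [int (u (Suc n)) = g ^ u n] (mod int p) \<and> u (Suc n) \<in> {1..p - 1})"

text \<open>
  The least \<open>t \<ge> 1\<close> is chosen first, and then the least \<open>s\<close> for that \<open>t\<close>.
  Both are meaningful only for eventually periodic sequences, which
  includes every sequence satisfying \<^const>\<open>exp_seq\<close>.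
\<close>

definition period :: "(nat \<Rightarrow> 'a) \<Rightarrow> nat" where
  "period u = (LEAST t. t \<ge> 1 \<and> (\<exists>s. \<forall>n\<ge>s. u n = u (n + t)))"

definition preperiod :: "(nat \<Rightarrow> 'a) \<Rightarrow> nat" where
  "preperiod u = (LEAST s. \<forall>n\<ge>s. u n = u (n + period u))"

definition trajectory_length :: "(nat \<Rightarrow> 'a) \<Rightarrow> nat" where
  "trajectory_length u = preperiod u + period u"

definition low_bits :: "nat \<Rightarrow> (nat \<Rightarrow> nat) \<Rightarrow> nat \<Rightarrow> nat" where
  "low_bits k u n = u n mod 2 ^ k"

definition distinct_low_bits :: "nat \<Rightarrow> (nat \<Rightarrow> nat) \<Rightarrow> nat \<Rightarrow> nat" where
  "distinct_low_bits k u N = card (low_bits k u ` {0..<N})"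

definition main_term :: "nat \<Rightarrow> nat \<Rightarrow> nat \<Rightarrow> real" where
  "main_term p k N =
     (if real N \<le> real p powr (1/2)
        then real N powr (6/11) * (2 ^ k / real p) powr (1/2)
      else if real N \<le> real p powr (35/68)
        then real N powr (7/12) * 2 powr (real k / 2) * real p powr (- 13/24)
      else if real N \<le> real p powr (13/24)
        then real N powr (5/11) * 2 powr (real k / 2) * real p powr (- 9/22)
      else if real N \<le> real p powr (2/3)
        then real N * 2 powr (real k / 2) * real p powr (- 1)
      else real N powr (1/4) * 2 powr (real k / 2) * real p powr (- 1/4))"

end

theory Submission
  imports Defs "HOL-Analysis.Convex" "HOL-Library.Real_Mod"
begin

text \<open>
  Let \<open>\<nu>\<close> be the number of low parts among \<open>u 0, ..., u (N - 1)\<close>, and let \<open>l\<close>, which is about \<open>p / 2 ^ k\<close>, be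
  the number of possible high parts. These \<open>N\<close> terms are distinct and form a set \<open>A\<close> with at most
  \<open>2 * \<nu>\<^sup>2 * l\<close> differences. The sequence converts differences into ratios: \<open>u (m + 1) / u (n + 1)\<close> is the
  power of \<open>g\<close> with exponent \<open>u m - u n\<close>. So any subset of \<open>A\<close> avoiding \<open>u 0\<close> has at most
  \<open>2 * \<nu>\<^sup>2 * l\<close> ratios modulo \<open>p\<close>. A lower bound for the number of ratios is therefore a lower bound for
  \<open>M = \<nu>\<^sup>2 * l\<close>, and the claim is a lower bound for \<open>M\<close> in terms of \<open>N\<close> and \<open>p\<close>.

  Instead of a general sum-product theorem, the proof exploits that some low part is shared by at
  least \<open>(N - 1) / \<nu>\<close> terms; up to a scaling they lie in an interval of length \<open>l\<close>
  (\<open>exp_seq_structure\<close>). For subsets of an interval much more is known than for general sets, because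
  coincidences between fractions with small numerators and with denominators in an interval can be
  counted with the divisor bound (\<open>card_ratio_quads_le\<close>). This count is used twice.

  The multiplicative energy (\<open>card_ratio_set_ge_energy\<close>) shows that \<open>M ^ 3\<close> is at least \<open>N ^ 4\<close>, up to a
  factor \<open>l\<^sup>2 / p + 1\<close> and a small power of \<open>l\<close>. As \<open>M \<ge> l\<close>, the claim is trivial for large \<open>l\<close>, and in the
  remaining cases with \<open>N \<le> p powr (1/2)\<close> the losses are affordable.

  For larger \<open>N\<close> the factor \<open>l\<^sup>2 / p\<close> would be fatal. It comes from the main term of the energy, so a
  Fourier argument with a Fejer kernel separates this main term (\<open>card_ratio_set_ge_fourier\<close>). The
  outcome is that \<open>M\<close> is of order at least \<open>p\<close>, or \<open>M\<^sup>2\<close> of order at least \<open>N * p\<close>, or \<open>M ^ 3\<close> of order at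
  least \<open>N ^ 4 * p powr (-1/12)\<close>. Each of these suffices in all ranges above \<open>p powr (1/2)\<close>. The
  exponents leave room for the divisor function, so that in the end only a constant is lost, and the
  factor \<open>N powr (- \<epsilon>)\<close> absorbs it.
\<close>

section \<open>The divisor bound\<close>

text \<open>
  A divisor of \<open>n\<close> is determined by its multiplicities at the primes dividing \<open>n\<close>, and each of
  these is at most the multiplicity in \<open>n\<close>.
\<close>

lemma card_divisors_le_prod_multiplicity:
  fixes n :: nat
  assumes "n > 0"
  shows "card {d. d dvd n} \<le> (\<Prod>q\<in>prime_factors n. multiplicity q n + 1)"
proof -
  let ?P = "prime_factors n"
  let ?f = "\<lambda>d::nat. restrict (\<lambda>q. multiplicity q d) ?P"
  have "inj_on ?f {d. d dvd n}"
  proof (rule inj_onI)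
    fix d e assume de: "d \<in> {d. d dvd n}" "e \<in> {d. d dvd n}" and eq: "?f d = ?f e"
    have pos: "d \<noteq> 0" "e \<noteq> 0" using de assms by auto
    have "multiplicity q d = multiplicity q e" if "prime q" for q
    proof (cases "q \<in> ?P")
      case True
      then show ?thesis using fun_cong[OF eq, of q] by simp
    next
      case False
      then have "\<not> q dvd n" using that assms by (auto simp: prime_factors_dvd)
      then have "\<not> q dvd d" "\<not> q dvd e" using de by (auto dest: dvd_trans)
      then show ?thesis by (simp add: not_dvd_imp_multiplicity_0)
    qed
    then show "d = e" using multiplicity_eq_imp_eq[OF pos] by simp
  qed
  moreover have "?f ` {d. d dvd n} \<subseteq> Pi\<^sub>E ?P (\<lambda>q. {..multiplicity q n})"
    using assms by (auto intro!: dvd_imp_multiplicity_le)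
  ultimately have "card {d. d dvd n} \<le> card (Pi\<^sub>E ?P (\<lambda>q. {..multiplicity q n}))"
    by (intro card_inj_on_le) (auto intro!: finite_PiE)
  then show ?thesis by (simp add: card_PiE)
qed

text \<open>
  By the previous lemma it is enough to compare, prime by prime, the factor \<open>e + 1\<close> with
  \<open>(q ^ e) powr \<delta>\<close>. For \<open>q \<ge> 2 powr (1 / \<delta>)\<close> the latter is at least \<open>2 ^ e\<close> and wins outright; each of
  the finitely many smaller primes costs at most a constant factor \<open>K\<close>.
\<close>

lemma card_divisors_le_powr:
  fixes \<delta> :: real
  assumes "\<delta> > 0"
  shows "\<exists>C\<ge>1. \<forall>n::nat. n > 0 \<longrightarrow> real (card {d. d dvd n}) \<le> C * real n powr \<delta>"
proof -
  define K where "K = max 1 (1 / (\<delta> * ln 2))"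
  define B where "B = nat \<lceil>2 powr (1/\<delta>)\<rceil>"
  define k where "k = (\<lambda>q. if q < B then K else 1)"
  have K: "K \<ge> 1" "K * (\<delta> * ln 2) \<ge> 1"
  proof -
    show "K \<ge> 1" by (simp add: K_def)
    have "1 / (\<delta> * ln 2) * (\<delta> * ln 2) \<le> K * (\<delta> * ln 2)"
      using assms by (intro mult_right_mono) (auto simp: K_def)
    then show "K * (\<delta> * ln 2) \<ge> 1" using assms by simp
  qed
  have loc: "real e + 1 \<le> k q * real (q ^ e) powr \<delta>" if "prime q" for q e :: nat
  proof -
    have q2: "q \<ge> 2" using that by (rule prime_ge_2_nat)
    have pw: "real (q ^ e) powr \<delta> = real q powr (\<delta> * real e)"
      using q2 by (simp add: powr_powr mult.commute flip: powr_realpow)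
    show ?thesis
    proof (cases "q < B")
      case True
      have "1 + \<delta> * e * ln 2 \<le> exp (\<delta> * e * ln 2)" by (rule exp_ge_add_one_self)
      also have "\<dots> = 2 powr (\<delta> * e)" by (simp add: powr_def)
      also have "\<dots> \<le> real q powr (\<delta> * real e)"
        using q2 assms by (intro powr_mono2) auto
      finally have 1: "1 + \<delta> * e * ln 2 \<le> real q powr (\<delta> * real e)" .
      have "1 + real e \<le> K * 1 + K * (\<delta> * ln 2) * e"
        using K mult_right_mono[OF K(2), of "real e"] by simp
      also have "\<dots> = K * (1 + \<delta> * e * ln 2)" by (simp add: algebra_simps)
      also have "\<dots> \<le> K * real q powr (\<delta> * real e)" using 1 K by (intro mult_left_mono) auto
      finally show ?thesis using True pw by (simp add: k_def)
    next
      case False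
      have "2 powr (1/\<delta>) \<le> real q" using False unfolding B_def by linarith
      then have "(2 powr (1/\<delta>)) powr \<delta> \<le> real q powr \<delta>" using assms by (intro powr_mono2) auto
      then have "2 \<le> real q powr \<delta>" using assms by (simp add: powr_powr)
      then have "2 ^ e \<le> (real q powr \<delta>) ^ e" by (intro power_mono) auto
      also have "\<dots> = real q powr (\<delta> * real e)"
        using q2 by (simp add: powr_powr flip: powr_realpow)
      finally have "2 ^ e \<le> real q powr (\<delta> * real e)" .
      moreover have "real e + 1 \<le> 2 ^ e"
        using of_nat_mono[OF Suc_leI[OF less_exp[of e]], where 'a = real] by simp
      ultimately show ?thesis using False pw by (simp add: k_def)
    qed
  qed
  show ?thesis
  proof (intro exI[of _ "K ^ B"] conjI allI impI)
    show "1 \<le> K ^ B" using K by (simp add: one_le_power)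
    fix n :: nat assume n: "n > 0"
    let ?P = "prime_factors n"
    have "real (card {d. d dvd n}) \<le> real (\<Prod>q\<in>?P. multiplicity q n + 1)"
      using card_divisors_le_prod_multiplicity[OF n] by (simp only: of_nat_le_iff)
    also have "\<dots> = (\<Prod>q\<in>?P. real (multiplicity q n) + 1)" by (simp add: of_nat_prod add.commute)
    also have "\<dots> \<le> (\<Prod>q\<in>?P. k q * real (q ^ multiplicity q n) powr \<delta>)"
      by (intro prod_mono conjI loc) auto
    also have "\<dots> = (\<Prod>q\<in>?P. k q) * (\<Prod>q\<in>?P. real (q ^ multiplicity q n) powr \<delta>)"
      by (rule prod.distrib)
    also have "(\<Prod>q\<in>?P. real (q ^ multiplicity q n) powr \<delta>) = (\<Prod>q\<in>?P. real (q ^ multiplicity q n)) powr \<delta>"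
      by (rule prod_powr_distrib [symmetric])
    also have "(\<Prod>q\<in>?P. real (q ^ multiplicity q n)) = real n"
      using prod_prime_factors[of n] n by (metis bot_nat_0.not_eq_extremum normalize_nat_def of_nat_prod id_apply)
    also have "(\<Prod>q\<in>?P. k q) = K ^ card (?P \<inter> {..<B})"
      unfolding k_def by (subst prod.If_cases) (auto simp: lessThan_def)
    also have "\<dots> * real n powr \<delta> \<le> K ^ B * real n powr \<delta>"
    proof (intro mult_right_mono power_increasing K)
      have "card (?P \<inter> {..<B}) \<le> card {..<B}" by (intro card_mono) auto
      then show "card (?P \<inter> {..<B}) \<le> B" by simp
    qed simp
    finally show "real (card {d. d dvd n}) \<le> K ^ B * real n powr \<delta>" .
  qed
qed

section \<open>Coincidences between fractions with small numerators\<close>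

lemma card_cong_interval_le:
  fixes p m Y r :: int
  assumes "p > 0" "Y \<ge> 0"
  shows "real (card {n \<in> {m..m + Y}. [n = r] (mod p)}) \<le> Y / p + 1"
proof -
  let ?S = "{n \<in> {m..m + Y}. [n = r] (mod p)}"
  have "inj_on (\<lambda>n. (n - m) div p) ?S"
  proof (rule inj_onI)
    fix x y assume xy: "x \<in> ?S" "y \<in> ?S" "(x - m) div p = (y - m) div p"
    have "[x - m = y - m] (mod p)" using xy by (intro cong_diff cong_refl) (auto simp: cong_def)
    then have "(x - m) mod p = (y - m) mod p" by (simp add: cong_def)
    then have "x - m = y - m" using xy(3) by (metis div_mult_mod_eq)
    then show "x = y" by simp
  qed
  moreover have "(\<lambda>n. (n - m) div p) ` ?S \<subseteq> {0..Y div p}"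
    using assms by (auto intro!: zdiv_mono1 simp: pos_imp_zdiv_nonneg_iff)
  ultimately have "card ?S \<le> card {0..Y div p}" by (intro card_inj_on_le) auto
  moreover have "Y div p \<ge> 0" using assms by (simp add: pos_imp_zdiv_nonneg_iff)
  ultimately have "int (card ?S) \<le> Y div p + 1" by simp
  then have "real (card ?S) \<le> real_of_int (Y div p) + 1" by linarith
  also have "real_of_int (Y div p) \<le> Y / p" by (rule real_of_int_div4)
  finally show ?thesis by simp
qed

lemma card_int_divisors_le:
  fixes n :: int
  assumes "n \<noteq> 0"
  shows "card {b. b dvd n} \<le> 2 * card {d. d dvd nat \<bar>n\<bar>}"
proof -
  let ?D = "{d. d dvd nat \<bar>n\<bar>}"
  have fin: "finite ?D" using assms by (intro finite_divisors_nat) simp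
  have "{b. b dvd n} \<subseteq> int ` ?D \<union> (\<lambda>d. - int d) ` ?D"
  proof
    fix b assume "b \<in> {b. b dvd n}"
    then have "nat \<bar>b\<bar> \<in> ?D" by (simp add: nat_abs_dvd_iff)
    moreover have "b = int (nat \<bar>b\<bar>) \<or> b = - int (nat \<bar>b\<bar>)" by linarith
    ultimately show "b \<in> int ` ?D \<union> (\<lambda>d. - int d) ` ?D" by blast
  qed
  then have "card {b. b dvd n} \<le> card (int ` ?D \<union> (\<lambda>d. - int d) ` ?D)"
    using fin by (intro card_mono) auto
  also have "\<dots> \<le> card (int ` ?D) + card ((\<lambda>d. - int d) ` ?D)" by (rule card_Un_le)
  also have "\<dots> \<le> card ?D + card ?D" using fin by (intro add_mono card_image_le)
  finally show ?thesis by simp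
qed

text \<open>
  For residues \<open>s + i\<close> in a short interval, these are the coincidences \<open>a / (s + i) = b / (s + j)\<close> with
  small nonzero numerators. They control both the multiplicative energy of a subset of an
  interval and the second moment of the exponential sums used further below.
\<close>

definition ratio_quads :: "int \<Rightarrow> int \<Rightarrow> int \<Rightarrow> int set \<Rightarrow> (int \<times> int \<times> int \<times> int) set" where
  "ratio_quads p s H E = {(a, b, i, j). a \<in> {-H..H} - {0} \<and> b \<in> {-H..H} - {0} \<and>
     i \<in> E \<and> j \<in> E \<and> [a * (s + j) = b * (s + i)] (mod p)}"

lemma finite_ratio_quads:
  assumes "finite E"
  shows "finite (ratio_quads p s H E)"
proof (rule finite_subset)
  show "ratio_quads p s H E \<subseteq> {-H..H} \<times> {-H..H} \<times> E \<times> E" by (auto simp: ratio_quads_def)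
qed (use assms in auto)

text \<open>
  Subtracting \<open>b * (s + j)\<close> turns the congruence into \<open>b * (i - j) \<equiv> (a - b) * (s + j)\<close>. Fix \<open>d = a - b\<close> and
  \<open>j\<close>: the integer \<open>n = b * (i - j)\<close> then lies in a fixed residue class and satisfies \<open>\<bar>n\<bar> \<le> H * L\<close>, so it
  takes at most \<open>2 * H * L / p + 1\<close> values, and if \<open>n \<noteq> 0\<close>, then \<open>b\<close> is one of its at most \<open>2 * \<tau>\<close>
  divisors. The case \<open>n = 0\<close> forces \<open>i = j\<close> and then \<open>a = b\<close>, because
  \<open>s + i\<close> is invertible and \<open>2 * H < p\<close>.
\<close>

lemma card_ratio_quads_le:
  fixes p s H L :: int and \<tau> :: real
  assumes p: "p > 0" and H: "0 \<le> H" "2 * H < p" and L: "0 \<le> L" and E: "E \<subseteq> {0..<L}"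
    and cop: "\<And>i. i \<in> E \<Longrightarrow> coprime (s + i) p"
    and \<tau>: "\<And>n. 0 < n \<Longrightarrow> n \<le> nat (H * L) \<Longrightarrow> real (card {d. d dvd n}) \<le> \<tau>"
    and \<tau>0: "\<tau> \<ge> 0"
  shows "real (card (ratio_quads p s H E))
           \<le> 2 * H * L + (4 * H + 1) * L * (2 * H * L / p + 1) * (2 * \<tau>)"
proof -
  have finE: "finite E" using E finite_subset by blast
  \<comment> \<open>The diagonal \<open>D\<close>; \<open>S d j\<close> holds the possible \<open>n\<close>, and \<open>W d j\<close> rebuilds the quadruples from \<open>n\<close> and \<open>b\<close>.\<close>
  define D where "D = (\<lambda>(a, i). (a, a, i, i)) ` (({-H..H} - {0}) \<times> {0..<L})"
  define S where "S = (\<lambda>d j. {n \<in> {-(H*L)..-(H*L) + 2*(H*L)}. [n = d * (s + j)] (mod p)} - {0::int})"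
  define W where "W = (\<lambda>d j. \<Union>n\<in>S d j. (\<lambda>b. (b + d, b, j + n div b, j)) ` {b. b dvd n})"
  have HL: "H * L \<ge> 0" using H L by simp
  have finS: "finite (S d j)" for d j
    unfolding S_def by (intro finite_Diff finite_subset[OF Collect_restrict]) simp
  have sub: "ratio_quads p s H E \<subseteq> D \<union> (\<Union>d\<in>{-2*H..2*H}. \<Union>j\<in>{0..<L}. W d j)"
  proof
    fix x assume "x \<in> ratio_quads p s H E"
    then obtain a b i j where x: "x = (a, b, i, j)" and ab: "a \<in> {-H..H} - {0}" "b \<in> {-H..H} - {0}"
      and ij: "i \<in> E" "j \<in> E" and c: "[a * (s + j) = b * (s + i)] (mod p)"
      by (auto simp: ratio_quads_def)
    show "x \<in> D \<union> (\<Union>d\<in>{-2*H..2*H}. \<Union>j\<in>{0..<L}. W d j)"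
    proof (cases "i = j")
      case True
      then have "[a = b] (mod p)" using c cop[OF ij(1)] by (simp add: cong_mult_rcancel)
      then have "p dvd a - b" by (simp add: cong_iff_dvd_diff)
      moreover have "\<bar>a - b\<bar> < p" using ab H by auto
      ultimately have "a = b" using dvd_imp_le_int[of "a - b" p] p by force
      then show ?thesis using True ab ij E by (auto simp: x D_def)
    next
      case False
      define n where "n = b * (i - j)"
      have "i \<in> {0..<L}" "j \<in> {0..<L}" using ij E by blast+
      then have "\<bar>i - j\<bar> \<le> L" by auto
      moreover have "\<bar>b\<bar> \<le> H" using ab by auto
      ultimately have nb: "\<bar>n\<bar> \<le> H * L" unfolding n_def abs_mult using H by (intro mult_mono) auto
      have "[b * (s + i) - b * (s + j) = a * (s + j) - b * (s + j)] (mod p)"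
        by (rule cong_diff [OF cong_sym [OF c] cong_refl])
      then have "[n = (a - b) * (s + j)] (mod p)" by (simp add: n_def algebra_simps)
      moreover have "n \<noteq> 0" using False ab by (simp add: n_def)
      ultimately have "n \<in> S (a - b) j" using nb by (auto simp: S_def)
      moreover have "x = (\<lambda>b. (b + (a - b), b, j + n div b, j)) b" using ab by (simp add: x n_def)
      ultimately have "x \<in> W (a - b) j" unfolding W_def using ab
        by (intro UN_I[of n]) (auto simp: x n_def intro!: image_eqI[of _ _ b])
      moreover have "a - b \<in> {-2*H..2*H}" using ab by auto
      moreover have "j \<in> {0..<L}" using ij E by auto
      ultimately show ?thesis by blast
    qed
  qed
  have cardW: "real (card (W d j)) \<le> (2 * H * L / p + 1) * (2 * \<tau>)" for d j
  proof -
    have "real (card (W d j)) \<le> real (\<Sum>n\<in>S d j. card ((\<lambda>b. (b + d, b, j + n div b, j)) ` {b. b dvd n}))"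
      unfolding W_def using finS by (intro of_nat_mono card_UN_le)
    also have "\<dots> \<le> (\<Sum>n\<in>S d j. 2 * \<tau>)" unfolding of_nat_sum
    proof (intro sum_mono)
      fix n assume n: "n \<in> S d j"
      then have n0: "n \<noteq> 0" "\<bar>n\<bar> \<le> H * L" by (auto simp: S_def)
      have "card ((\<lambda>b. (b + d, b, j + n div b, j)) ` {b. b dvd n}) \<le> card {b. b dvd n}"
        using n0 by (intro card_image_le) auto
      also have "\<dots> \<le> 2 * card {d. d dvd nat \<bar>n\<bar>}" by (rule card_int_divisors_le[OF n0(1)])
      finally have "real (card ((\<lambda>b. (b + d, b, j + n div b, j)) ` {b. b dvd n})) \<le> 2 * real (card {d. d dvd nat \<bar>n\<bar>})"
        by linarith
      also have "\<dots> \<le> 2 * \<tau>" using n0 by (intro mult_left_mono \<tau>) auto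
      finally show "real (card ((\<lambda>b. (b + d, b, j + n div b, j)) ` {b. b dvd n})) \<le> 2 * \<tau>" .
    qed
    also have "\<dots> = real (card (S d j)) * (2 * \<tau>)" by simp
    also have "\<dots> \<le> (2 * H * L / p + 1) * (2 * \<tau>)"
    proof (intro mult_right_mono)
      have "real (card (S d j)) \<le> real (card {n \<in> {-(H*L)..-(H*L) + 2*(H*L)}. [n = d * (s + j)] (mod p)})"
        unfolding S_def by (intro of_nat_mono card_mono finite_subset[OF Collect_restrict]) auto
      also have "\<dots> \<le> real_of_int (2*(H*L)) / p + 1" using p HL by (intro card_cong_interval_le) auto
      finally show "real (card (S d j)) \<le> 2 * H * L / p + 1" by (simp add: mult.assoc)
    qed (use \<tau>0 in auto)
    finally show ?thesis .
  qed
  have finW: "finite (W d j)" for d j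
    unfolding W_def using finS by (auto simp: S_def)
  have "card (ratio_quads p s H E) \<le> card (D \<union> (\<Union>d\<in>{-2*H..2*H}. \<Union>j\<in>{0..<L}. W d j))"
    using sub finW by (intro card_mono) (auto simp: D_def)
  also have "\<dots> \<le> card D + card (\<Union>d\<in>{-2*H..2*H}. \<Union>j\<in>{0..<L}. W d j)" by (rule card_Un_le)
  also have "card (\<Union>d\<in>{-2*H..2*H}. \<Union>j\<in>{0..<L}. W d j) \<le> (\<Sum>d\<in>{-2*H..2*H}. \<Sum>j\<in>{0..<L}. card (W d j))"
    by (intro order.trans[OF card_UN_le] sum_mono card_UN_le) auto
  finally have "real (card (ratio_quads p s H E)) \<le> real (card D) + (\<Sum>d\<in>{-2*H..2*H}. \<Sum>j\<in>{0..<L}. real (card (W d j)))"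
    by (simp flip: of_nat_sum of_nat_add)
  also have "(\<Sum>d\<in>{-2*H..2*H}. \<Sum>j\<in>{0..<L}. real (card (W d j)))
      \<le> (\<Sum>d\<in>{-2*H..2*H}. \<Sum>j\<in>{0..<L}. (2 * H * L / p + 1) * (2 * \<tau>))"
    by (intro sum_mono cardW)
  also have "\<dots> = (4 * H + 1) * L * (2 * H * L / p + 1) * (2 * \<tau>)"
    using H L by (simp add: mult.assoc)
  also have "real (card D) \<le> 2 * H * L"
  proof -
    have "card D \<le> card (({-H..H} - {0}) \<times> {0..<L})" unfolding D_def by (intro card_image_le) auto
    also have "\<dots> = nat (2 * H) * nat L"
    proof -
      have "card ({-H..H} - {0}) = nat (2 * H)" using H by (simp add: card_Diff_singleton_if)
      then show ?thesis by (simp add: card_cartesian_product)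
    qed
    finally have "real (card D) \<le> real (nat (2 * H) * nat L)" by (rule of_nat_mono)
    then show ?thesis using H L by (simp only: of_nat_mult of_nat_nat mult_nonneg_nonneg zero_le_numeral of_int_mult of_int_numeral)
  qed
  finally show ?thesis by linarith
qed

section \<open>Additive characters modulo an integer\<close>

text \<open>
  The additive character \<open>x \<mapsto> e(x / p)\<close> of the integers modulo \<open>p\<close>.
\<close>

definition add_char :: "int \<Rightarrow> int \<Rightarrow> complex" where
  "add_char p x = cis (2 * pi * x / p)"

lemma norm_add_char [simp]: "norm (add_char p x) = 1"
  by (simp add: add_char_def)

lemma add_char_0 [simp]: "add_char p 0 = 1"
  by (simp add: add_char_def)

lemma add_char_add: "add_char p (x + y) = add_char p x * add_char p y"
  by (simp add: add_char_def cis_mult add_divide_distrib ring_distribs)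

lemma cnj_add_char: "cnj (add_char p x) = add_char p (- x)"
  by (simp add: add_char_def cis_cnj)

lemma add_char_mult_cnj: "add_char p x * cnj (add_char p y) = add_char p (x - y)"
  by (simp add: cnj_add_char flip: add_char_add)

lemma add_char_power: "add_char p (int n * x) = add_char p x ^ n"
  by (simp add: add_char_def DeMoivre mult_ac)

lemma add_char_eq_1_iff:
  assumes "p > 0"
  shows "add_char p x = 1 \<longleftrightarrow> p dvd x"
proof -
  have "add_char p x = 1 \<longleftrightarrow> (\<exists>n. 2 * pi * x / p = of_int n * (2 * pi))"
    by (simp add: add_char_def cis_eq_1_iff)
  also have "\<dots> \<longleftrightarrow> (\<exists>n. real_of_int x = real_of_int (p * n))"
    using assms by (simp add: field_simps)
  also have "\<dots> \<longleftrightarrow> p dvd x" by (simp only: of_int_eq_iff dvd_def)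
  finally show ?thesis .
qed

lemma add_char_cong:
  assumes "p > 0" "[x = y] (mod p)"
  shows "add_char p x = add_char p y"
proof -
  have "add_char p (x - y) = 1" using assms by (simp add: add_char_eq_1_iff cong_iff_dvd_diff)
  then show ?thesis using add_char_add[of p "x - y" y] by simp
qed

lemma sum_add_char:
  assumes "p > 0"
  shows "(\<Sum>q\<in>{0..<p}. add_char p (q * m)) = (if p dvd m then of_int p else 0)"
proof -
  let ?z = "add_char p m"
  have "(\<Sum>q\<in>{0..<p}. add_char p (q * m)) = (\<Sum>n<nat p. add_char p (int n * m))"
    using assms by (intro sum.reindex_bij_witness[of _ int nat]) auto
  also have "\<dots> = (\<Sum>n<nat p. ?z ^ n)" by (simp add: add_char_power)
  also have "\<dots> = (if p dvd m then of_int p else 0)"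
  proof (cases "p dvd m")
    case True
    then have "?z = 1" using assms by (simp add: add_char_eq_1_iff)
    then show ?thesis using True assms by simp
  next
    case False
    then have z: "?z \<noteq> 1" using assms by (simp add: add_char_eq_1_iff)
    have "?z ^ nat p = add_char p (p * m)" using assms by (simp flip: add_char_power)
    also have "\<dots> = 1" using assms by (simp add: add_char_eq_1_iff)
    finally show ?thesis using False z by (simp add: geometric_sum)
  qed
  finally show ?thesis .
qed

text \<open>
  Expanding the square and summing over a complete residue system leaves, by orthogonality, only
  the pairs of frequencies that agree modulo \<open>p\<close>.
\<close>

lemma mean_square_add_char_sum_le:
  fixes w :: "'a \<Rightarrow> complex" and m :: "'a \<Rightarrow> int"
  assumes p: "p > 0" and fin: "finite X" and w: "\<And>x. x \<in> X \<Longrightarrow> norm (w x) \<le> 1"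
  shows "(\<Sum>q\<in>{0..<p}. (norm (\<Sum>x\<in>X. w x * add_char p (q * m x)))\<^sup>2)
           \<le> real_of_int p * real (card {(x, y). x \<in> X \<and> y \<in> X \<and> [m x = m y] (mod p)})"
proof -
  let ?R = "\<Sum>q\<in>{0..<p}. (norm (\<Sum>x\<in>X. w x * add_char p (q * m x)))\<^sup>2"
  have "complex_of_real ?R = (\<Sum>q\<in>{0..<p}. \<Sum>x\<in>X. \<Sum>y\<in>X. w x * cnj (w y) * add_char p (q * (m x - m y)))"
  proof -
    have "complex_of_real ((norm (\<Sum>x\<in>X. w x * add_char p (q * m x)))\<^sup>2)
        = (\<Sum>x\<in>X. \<Sum>y\<in>X. w x * cnj (w y) * add_char p (q * (m x - m y)))" for q
      unfolding complex_norm_square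
      by (simp add: sum_product right_diff_distrib flip: add_char_mult_cnj) (simp add: mult_ac)
    then show ?thesis by (simp only: of_real_sum)
  qed
  also have "\<dots> = (\<Sum>x\<in>X. \<Sum>q\<in>{0..<p}. \<Sum>y\<in>X. w x * cnj (w y) * add_char p (q * (m x - m y)))"
    by (rule sum.swap)
  also have "\<dots> = (\<Sum>x\<in>X. \<Sum>y\<in>X. \<Sum>q\<in>{0..<p}. w x * cnj (w y) * add_char p (q * (m x - m y)))"
    by (intro sum.cong refl sum.swap)
  also have "\<dots> = (\<Sum>x\<in>X. \<Sum>y\<in>X. w x * cnj (w y) * (if p dvd m x - m y then of_int p else 0))"
    by (simp only: sum_add_char[OF p] flip: sum_distrib_left)
  finally have eq: "complex_of_real ?R = \<dots>" .
  have "?R \<le> norm (complex_of_real ?R)" unfolding norm_of_real by (rule abs_ge_self)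
  also have "\<dots> \<le> (\<Sum>x\<in>X. \<Sum>y\<in>X. norm (w x * cnj (w y) * (if p dvd m x - m y then of_int p else 0)))"
    unfolding eq by (intro order.trans[OF norm_sum] sum_mono norm_sum)
  also have "\<dots> \<le> (\<Sum>x\<in>X. \<Sum>y\<in>X. (if [m x = m y] (mod p) then real_of_int p else 0))"
  proof (intro sum_mono)
    fix x y assume "x \<in> X" "y \<in> X"
    then have "norm (w x) * norm (w y) \<le> 1 * 1" by (intro mult_mono w) auto
    then show "norm (w x * cnj (w y) * (if p dvd m x - m y then of_int p else 0))
        \<le> (if [m x = m y] (mod p) then real_of_int p else 0)"
      using p by (auto simp: norm_mult cong_iff_dvd_diff intro: mult_left_le_one_le)
  qed
  also have "\<dots> = (\<Sum>z\<in>X \<times> X. (if [m (fst z) = m (snd z)] (mod p) then real_of_int p else 0))"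
    by (simp add: sum.cartesian_product case_prod_unfold)
  also have "\<dots> = (\<Sum>z\<in>{z \<in> X \<times> X. [m (fst z) = m (snd z)] (mod p)}. real_of_int p)"
    using fin by (simp only: sum.inter_filter finite_cartesian_product)
  also have "{z \<in> X \<times> X. [m (fst z) = m (snd z)] (mod p)} = {(x, y). x \<in> X \<and> y \<in> X \<and> [m x = m y] (mod p)}"
    by auto
  finally show ?thesis by (simp add: mult.commute)
qed

text \<open>
  The square of its absolute value is \<open>H\<close> times the Fejer kernel. It serves as a smooth majorant
  of an interval: it is of size \<open>H\<^sup>2\<close> on an interval of length about \<open>p / H\<close>, and only frequencies
  below \<open>H\<close> occur in it, so that no sharp cut-off has to be expanded.
\<close>

definition dirichlet_sum :: "int \<Rightarrow> int \<Rightarrow> int \<Rightarrow> complex" where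
  "dirichlet_sum p H x = (\<Sum>a\<in>{0..<H}. add_char p (a * x))"

text \<open>
  All phases \<open>2 * pi * a * i / p\<close> lie in \<open>[0, pi / 3]\<close>, where the cosine is at least \<open>1 / 2\<close>.
\<close>

lemma norm_dirichlet_sum_ge:
  fixes p H L x i :: int
  assumes p: "p > 0" and H: "H \<ge> 0" and HL: "6 * H * L \<le> p" and i: "0 \<le> i" "i < L" "[x = i] (mod p)"
  shows "(norm (dirichlet_sum p H x))\<^sup>2 \<ge> H\<^sup>2 / 4"
proof -
  have "real_of_int H / 2 = (\<Sum>a\<in>{0..<H}. 1 / 2)" using H by simp
  also have "\<dots> \<le> (\<Sum>a\<in>{0..<H}. Re (add_char p (a * x)))"
  proof (intro sum_mono)
    fix a assume a: "a \<in> {0..<H}"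
    have "a * i \<le> H * L" using a i by (intro mult_mono) auto
    then have "6 * (a * i) \<le> p" using HL by linarith
    then have ai: "6 * real_of_int (a * i) \<le> p" by linarith
    have "[a * x = a * i] (mod p)" using i by (intro cong_mult cong_refl)
    then have "Re (add_char p (a * x)) = Re (add_char p (a * i))" using p by (metis add_char_cong)
    also have "\<dots> = cos (2 * pi * (a * i) / p)" by (simp add: add_char_def)
    also have "\<dots> \<ge> cos (pi / 3)"
    proof (intro cos_monotone_0_pi_le)
      show "0 \<le> 2 * pi * (a * i) / p" using a i p by simp
      have "pi * (6 * real_of_int (a * i)) \<le> pi * p" using ai by (intro mult_left_mono) auto
      then show "2 * pi * (a * i) / p \<le> pi / 3" using p by (simp add: field_simps)
    qed auto
    finally show "1 / 2 \<le> Re (add_char p (a * x))" by (simp add: cos_60)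
  qed
  also have "\<dots> = Re (dirichlet_sum p H x)" by (simp add: dirichlet_sum_def)
  also have "\<dots> \<le> norm (dirichlet_sum p H x)" by (rule complex_Re_le_cmod)
  finally have "(real_of_int H / 2)\<^sup>2 \<le> (norm (dirichlet_sum p H x))\<^sup>2" using H by (intro power_mono) auto
  then show ?thesis by (simp add: power_divide)
qed

lemma norm_dirichlet_sum_square:
  fixes p H x :: int
  assumes "H \<ge> 0"
  shows "(norm (dirichlet_sum p H x))\<^sup>2
           = H + Re (\<Sum>(a, b)\<in>{(a, b). a \<in> {0..<H} \<and> b \<in> {0..<H} \<and> a \<noteq> b}. add_char p ((a - b) * x))"
proof -
  let ?D = "{(a, b). a \<in> {0..<H} \<and> b \<in> {0..<H} \<and> a = b}"
  let ?X = "{(a, b). a \<in> {0..<H} \<and> b \<in> {0..<H} \<and> a \<noteq> b}"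
  have fin: "finite ?D" "finite ?X" by (rule finite_subset[of _ "{0..<H} \<times> {0..<H}"]; auto)+
  have "complex_of_real ((norm (dirichlet_sum p H x))\<^sup>2) = (\<Sum>a\<in>{0..<H}. \<Sum>b\<in>{0..<H}. add_char p ((a - b) * x))"
    unfolding complex_norm_square dirichlet_sum_def
    by (simp add: sum_product add_char_mult_cnj left_diff_distrib)
  also have "\<dots> = (\<Sum>(a, b)\<in>{0..<H} \<times> {0..<H}. add_char p ((a - b) * x))"
    by (simp add: sum.cartesian_product)
  also have "{0..<H} \<times> {0..<H} = ?D \<union> ?X" by auto
  also have "(\<Sum>(a, b)\<in>?D \<union> ?X. add_char p ((a - b) * x))
      = (\<Sum>(a, b)\<in>?D. add_char p ((a - b) * x)) + (\<Sum>(a, b)\<in>?X. add_char p ((a - b) * x))"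
    using fin by (intro sum.union_disjoint) auto
  also have "(\<Sum>(a, b)\<in>?D. add_char p ((a - b) * x)) = (\<Sum>a\<in>{0..<H}. 1)"
    by (rule sum.reindex_bij_witness[of _ "\<lambda>a. (a, a)" fst]) auto
  also have "\<dots> = complex_of_real (real_of_int H)" using assms by simp
  finally have "Re (complex_of_real ((norm (dirichlet_sum p H x))\<^sup>2))
      = Re (complex_of_real (real_of_int H) + (\<Sum>(a, b)\<in>?X. add_char p ((a - b) * x)))"
    by (rule arg_cong)
  then show ?thesis by simp
qed

section \<open>Lower bounds for the ratio set of a subset of an interval\<close>

text \<open>
  If \<open>Q\<close> contains all ratios of the set \<open>s + E\<close>, then among the pairs \<open>(q, j) \<in> Q \<times> E\<close> at least
  \<open>(card E)\<^sup>2\<close> have their product \<open>q * (s + j)\<close> in the interval starting at \<open>s\<close>. Counting these pairs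
  with the Fejer majorant, the diagonal terms give \<open>card E * card Q\<close>, the count expected if the
  products were equidistributed. The other terms are a sum over \<open>q\<close> of exponential sums at the
  frequencies \<open>(a - b) * (s + j)\<close>, which Cauchy--Schwarz and orthogonality bound through the number of
  coincidences between frequencies.
\<close>

lemma card_ratio_set_ge_fourier:
  fixes p s H L :: int and E Q :: "int set"
  assumes p: "p > 0" and H: "H \<ge> 1" and L: "6 * H * L \<le> p" and E: "E \<subseteq> {0..<L}"
    and Q: "Q \<subseteq> {0..<p}"
    and ratio: "\<And>i j. i \<in> E \<Longrightarrow> j \<in> E \<Longrightarrow> \<exists>q\<in>Q. [s + i = q * (s + j)] (mod p)"
  shows "H * (real (card E))\<^sup>2
           \<le> 4 * (real (card E) * card Q + sqrt (real_of_int p * real (card Q) * real (card (ratio_quads p s (H - 1) E))))"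
proof -
  have fin: "finite E" "finite Q" using E Q finite_subset by blast+
  define G where "G = (\<lambda>q j. (norm (dirichlet_sum p H (q * (s + j) - s)))\<^sup>2)"
  define X where "X = {(a, b). a \<in> {0..<H} \<and> b \<in> {0..<H} \<and> a \<noteq> b} \<times> E"
  define w where "w = (\<lambda>((a, b), j::int). add_char p (- ((a - b) * s)))"
  define m where "m = (\<lambda>((a, b), j). (a - b) * (s + j))"
  define T where "T = (\<lambda>q. \<Sum>x\<in>X. w x * add_char p (q * m x))"
  have finX: "finite X" unfolding X_def
    by (intro finite_cartesian_product fin finite_subset[of _ "{0..<H} \<times> {0..<H}"]) auto
  \<comment> \<open>Each pair \<open>(i, j)\<close> yields a pair (ratio, \<open>j\<close>); for fixed \<open>j\<close>, distinct \<open>i\<close> give distinct ratios because \<open>L \<le> p\<close>.\<close>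
  have lower: "(\<Sum>q\<in>Q. \<Sum>j\<in>E. G q j) \<ge> (real (card E))\<^sup>2 * (H\<^sup>2 / 4)"
  proof -
    obtain f where f: "\<And>i j. i \<in> E \<Longrightarrow> j \<in> E \<Longrightarrow> f i j \<in> Q \<and> [s + i = f i j * (s + j)] (mod p)"
      using ratio by metis
    let ?F = "\<lambda>(i, j). (f i j, j)"
    have inj: "inj_on ?F (E \<times> E)"
    proof (rule inj_onI)
      fix x y assume xy: "x \<in> E \<times> E" "y \<in> E \<times> E" "?F x = ?F y"
      obtain i j i' where x: "x = (i, j)" and y: "y = (i', j)" and ff: "f i j = f i' j" using xy by (cases x; cases y) auto
      have "[s + i = s + i'] (mod p)" using f[of i j] f[of i' j] xy ff x y by (metis cong_sym cong_trans mem_Sigma_iff)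
      then have "p dvd i - i'" by (simp add: cong_iff_dvd_diff)
      moreover have "i \<in> {0..<L}" "i' \<in> {0..<L}" using xy x y E by auto
      moreover have "L \<le> p"
      proof -
        have "0 < L" using \<open>i \<in> {0..<L}\<close> by auto
        moreover have "1 * L \<le> H * L" using H \<open>0 < L\<close> by (intro mult_right_mono) auto
        ultimately show ?thesis using L by linarith
      qed
      ultimately have "i = i'" using dvd_imp_le_int[of "i - i'" p] p by force
      then show "x = y" using x y by simp
    qed
    have "(real (card E))\<^sup>2 * (H\<^sup>2 / 4) = (\<Sum>x\<in>E \<times> E. H\<^sup>2 / 4)"
      by (simp add: card_cartesian_product power2_eq_square)
    also have "\<dots> \<le> (\<Sum>x\<in>E \<times> E. case ?F x of (q, j) \<Rightarrow> G q j)"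
    proof (intro sum_mono)
      fix x assume x: "x \<in> E \<times> E"
      obtain i j where ij: "x = (i, j)" by (cases x)
      have "[s + i - s = f i j * (s + j) - s] (mod p)" using f x ij by (intro cong_diff cong_refl) auto
      then have "[f i j * (s + j) - s = i] (mod p)" by (simp add: cong_sym)
      then have "G (f i j) j \<ge> H\<^sup>2 / 4" unfolding G_def
        using p H L x ij E by (intro norm_dirichlet_sum_ge[of p H L i]) auto
      then show "H\<^sup>2 / 4 \<le> (case ?F x of (q, j) \<Rightarrow> G q j)" by (simp add: ij)
    qed
    also have "\<dots> = (\<Sum>(q, j)\<in>?F ` (E \<times> E). G q j)" by (subst sum.reindex[OF inj]) (simp add: case_prod_unfold o_def)
    also have "\<dots> \<le> (\<Sum>(q, j)\<in>Q \<times> E. G q j)"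
      using f fin by (intro sum_mono2) (auto simp: G_def)
    finally show ?thesis by (simp add: sum.cartesian_product)
  qed
  have GT: "(\<Sum>j\<in>E. G q j) = H * card E + Re (T q)" for q
  proof -
    have "(\<Sum>j\<in>E. G q j) = (\<Sum>j\<in>E. real_of_int H + Re (\<Sum>(a, b)\<in>{(a, b). a \<in> {0..<H} \<and> b \<in> {0..<H} \<and> a \<noteq> b}.
        add_char p ((a - b) * (q * (s + j) - s))))"
      unfolding G_def using H by (intro sum.cong refl norm_dirichlet_sum_square) auto
    also have "\<dots> = H * card E + Re (\<Sum>j\<in>E. \<Sum>(a, b)\<in>{(a, b). a \<in> {0..<H} \<and> b \<in> {0..<H} \<and> a \<noteq> b}.
        add_char p ((a - b) * (q * (s + j) - s)))"
      by (simp add: sum.distrib)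
    also have "(\<Sum>j\<in>E. \<Sum>(a, b)\<in>{(a, b). a \<in> {0..<H} \<and> b \<in> {0..<H} \<and> a \<noteq> b}.
        add_char p ((a - b) * (q * (s + j) - s))) = T q"
      unfolding T_def X_def by (subst sum.swap, subst sum.cartesian_product)
        (auto intro!: sum.cong simp: w_def m_def algebra_simps simp flip: add_char_add)
    finally show ?thesis .
  qed
  \<comment> \<open>A coincidence of frequencies is a quadruple for the differences \<open>a - b\<close>, \<open>a' - b'\<close>; each difference arises from at most \<open>H\<close> pairs.\<close>
  have energy: "card {(x, y). x \<in> X \<and> y \<in> X \<and> [m x = m y] (mod p)} \<le> nat H * nat H * card (ratio_quads p s (H - 1) E)"
  proof -
    let ?S = "{(x, y). x \<in> X \<and> y \<in> X \<and> [m x = m y] (mod p)}"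
    let ?f = "\<lambda>(((a, b), j), ((a', b'), j')). (a, a', (a - b, a' - b', j', j))"
    have "inj_on ?f ?S" by (rule inj_onI) auto
    moreover have "?f ` ?S \<subseteq> {0..<H} \<times> {0..<H} \<times> ratio_quads p s (H - 1) E"
      by (auto simp: X_def m_def ratio_quads_def)
    ultimately have "card ?S \<le> card ({0..<H} \<times> {0..<H} \<times> ratio_quads p s (H - 1) E)"
      using fin by (intro card_inj_on_le) (auto intro!: finite_ratio_quads)
    then show ?thesis by (simp add: card_cartesian_product mult.assoc)
  qed
  let ?N = "real (card (ratio_quads p s (H - 1) E))"
  have "(\<Sum>q\<in>Q. (norm (T q))\<^sup>2) \<le> (\<Sum>q\<in>{0..<p}. (norm (T q))\<^sup>2)"
    using Q by (intro sum_mono2) auto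
  also have "\<dots> \<le> real_of_int p * real (card {(x, y). x \<in> X \<and> y \<in> X \<and> [m x = m y] (mod p)})"
    unfolding T_def using p finX by (intro mean_square_add_char_sum_le) (auto simp: w_def)
  also have "\<dots> \<le> real_of_int p * (H\<^sup>2 * ?N)"
  proof -
    have "real (card {(x, y). x \<in> X \<and> y \<in> X \<and> [m x = m y] (mod p)}) \<le> real (nat H * nat H * card (ratio_quads p s (H - 1) E))"
      using energy by (rule of_nat_mono)
    also have "\<dots> = H\<^sup>2 * ?N" using H by (simp add: power2_eq_square)
    finally show ?thesis using p by (intro mult_left_mono) auto
  qed
  finally have "(\<Sum>q\<in>Q. (norm (T q))\<^sup>2) \<le> real_of_int p * (H\<^sup>2 * ?N)" .
  then have "(\<Sum>q\<in>Q. (norm (T q))\<^sup>2) * card Q \<le> real_of_int p * (H\<^sup>2 * ?N) * card Q"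
    by (rule mult_right_mono) simp
  moreover have "(\<Sum>q\<in>Q. norm (T q))\<^sup>2 \<le> (\<Sum>q\<in>Q. (norm (T q))\<^sup>2) * card Q"
    by (rule sum_squared_le_sum_of_squares)
  ultimately have "(\<Sum>q\<in>Q. norm (T q))\<^sup>2 \<le> H\<^sup>2 * (real_of_int p * real (card Q) * ?N)"
    by (simp add: mult_ac)
  then have "(\<Sum>q\<in>Q. norm (T q)) \<le> sqrt (H\<^sup>2 * (real_of_int p * real (card Q) * ?N))" by (rule real_le_rsqrt)
  also have "\<dots> = H * sqrt (real_of_int p * real (card Q) * ?N)" using H by (simp add: real_sqrt_mult)
  finally have off: "(\<Sum>q\<in>Q. norm (T q)) \<le> H * sqrt (real_of_int p * real (card Q) * ?N)" .
  have "(real (card E))\<^sup>2 * (H\<^sup>2 / 4) \<le> (\<Sum>q\<in>Q. H * card E + Re (T q))"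
    using lower by (simp only: GT)
  also have "\<dots> \<le> (\<Sum>q\<in>Q. H * card E + norm (T q))"
    by (intro sum_mono add_mono order.refl complex_Re_le_cmod)
  also have "\<dots> = H * card E * card Q + (\<Sum>q\<in>Q. norm (T q))" by (simp add: sum.distrib)
  also have "\<dots> \<le> H * (real (card E) * card Q + sqrt (real_of_int p * real (card Q) * ?N))"
    using off by (simp add: algebra_simps)
  finally have "H * (H * (real (card E))\<^sup>2) \<le> H * (4 * (real (card E) * card Q + sqrt (real_of_int p * real (card Q) * ?N)))"
    by (simp add: power2_eq_square field_simps)
  then show ?thesis using H by (simp add: mult_le_cancel_left_pos)
qed

text \<open>
  By Cauchy--Schwarz it suffices to count the pairs of equal ratios
  \<open>(s + i) / (s + j) = (s + i') / (s + j')\<close>. Subtracting \<open>1\<close> on both sides turns such a pair into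
  \<open>(i - j) / (s + j) = (i' - j') / (s + j')\<close>, a coincidence with small numerators; both numerators vanish at
  once, in which case \<open>j\<close> and \<open>j'\<close> are free.
\<close>

lemma card_ratio_set_ge_energy:
  fixes p s L :: int and E Q :: "int set"
  assumes p: "p > 0" and L: "L \<ge> 0" "2 * (L - 1) < p" and E: "E \<subseteq> {0..<L}"
    and cop: "\<And>i. i \<in> E \<Longrightarrow> coprime (s + i) p" and Q: "finite Q"
    and ratio: "\<And>i j. i \<in> E \<Longrightarrow> j \<in> E \<Longrightarrow> \<exists>q\<in>Q. [s + i = q * (s + j)] (mod p)"
  shows "real (card E) ^ 4 \<le> real (card Q) * ((real_of_int L)\<^sup>2 + real (card (ratio_quads p s (L - 1) E)))"
proof -
  have fin: "finite E" using E finite_subset by blast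
  obtain f where f: "\<And>i j. i \<in> E \<Longrightarrow> j \<in> E \<Longrightarrow> f (i, j) \<in> Q \<and> [s + i = f (i, j) * (s + j)] (mod p)"
  proof -
    have "\<forall>x\<in>E \<times> E. \<exists>q. q \<in> Q \<and> [s + fst x = q * (s + snd x)] (mod p)" using ratio by force
    then obtain f where "\<forall>x\<in>E \<times> E. f x \<in> Q \<and> [s + fst x = f x * (s + snd x)] (mod p)" by metis
    then show ?thesis using that[of f] by force
  qed
  define P where "P = E \<times> E"
  define r where "r = (\<lambda>q. {x \<in> P. f x = q})"
  define Z where "Z = {(x, y). x \<in> P \<and> y \<in> P \<and> f x = f y}"
  have finP: "finite P" using fin by (simp add: P_def)
  have finZ: "finite Z" using finP by (intro finite_subset[of Z "P \<times> P"]) (auto simp: Z_def)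
  have fQ: "f ` P \<subseteq> Q" using f by (auto simp: P_def)
  have "card P = (\<Sum>q\<in>Q. card (r q))"
    unfolding r_def using sum_fun_comp[OF finP Q fQ, of "\<lambda>_. 1::nat"] by simp
  then have "(real (card P))\<^sup>2 = (\<Sum>q\<in>Q. real (card (r q)))\<^sup>2" by simp
  also have "\<dots> \<le> (\<Sum>q\<in>Q. (real (card (r q)))\<^sup>2) * card Q"
    by (rule sum_squared_le_sum_of_squares)
  also have "(\<Sum>q\<in>Q. (real (card (r q)))\<^sup>2) = card Z"
  proof -
    have "Z = (\<Union>q\<in>Q. r q \<times> r q)" using fQ by (auto simp: Z_def r_def)
    then have "card Z = card (\<Union>q\<in>Q. r q \<times> r q)" by simp
    also have "\<dots> = (\<Sum>q\<in>Q. card (r q \<times> r q))"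
      using Q finP by (intro card_UN_disjoint) (auto simp: r_def)
    finally show ?thesis by (simp add: card_cartesian_product power2_eq_square)
  qed
  finally have cs: "real (card E) ^ 4 \<le> card Z * card Q"
    by (simp add: P_def card_cartesian_product power4_eq_xxxx power2_eq_square mult_ac)
  let ?D = "(\<lambda>(i, j). ((i, i), (j, j))) ` (E \<times> E)"
  let ?g = "\<lambda>((i, j), (i', j')). (i - j, i' - j', j, j')"
  have "Z \<subseteq> ?D \<union> {z \<in> Z. ?g z \<in> ratio_quads p s (L - 1) E}"
  proof
    fix z assume z: "z \<in> Z"
    obtain i j i' j' where zz: "z = ((i, j), (i', j'))" by (metis surj_pair)
    then have mem: "i \<in> E" "j \<in> E" "i' \<in> E" "j' \<in> E" and ff: "f (i, j) = f (i', j')" using z by (auto simp: Z_def P_def)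
    let ?q = "f (i, j)"
    have 1: "[s + i = ?q * (s + j)] (mod p)" and 2: "[s + i' = ?q * (s + j')] (mod p)"
      using f[OF mem(1,2)] f[OF mem(3,4)] ff by simp_all
    have "[(s + i) * (s + j') = ?q * (s + j) * (s + j')] (mod p)" by (rule cong_scalar_right[OF 1])
    moreover have "[(s + i') * (s + j) = ?q * (s + j') * (s + j)] (mod p)" by (rule cong_scalar_right[OF 2])
    ultimately have "[(s + i) * (s + j') = (s + i') * (s + j)] (mod p)"
      by (metis cong_sym cong_trans mult.assoc mult.commute)
    then have "[(s + i) * (s + j') - (s + j) * (s + j') = (s + i') * (s + j) - (s + j) * (s + j')] (mod p)"
      by (intro cong_diff cong_refl)
    then have c: "[(i - j) * (s + j') = (i' - j') * (s + j)] (mod p)" by (simp add: algebra_simps)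
    have rng: "i \<in> {0..<L}" "j \<in> {0..<L}" "i' \<in> {0..<L}" "j' \<in> {0..<L}" using mem E by auto
    have z0: "a = b" if "p dvd a - b" "a \<in> {0..<L}" "b \<in> {0..<L}" for a b
      using dvd_imp_le_int[of "a - b" p] that p L by force
    show "z \<in> ?D \<union> {z \<in> Z. ?g z \<in> ratio_quads p s (L - 1) E}"
    proof (cases "i = j \<or> i' = j'")
      case True
      have "i = j \<and> i' = j'"
      proof (cases "i = j")
        case True
        then have "p dvd (i' - j') * (s + j)" using c by (simp add: cong_iff_dvd_diff)
        then show ?thesis using True z0 rng cop[OF mem(2)] by (simp add: coprime_dvd_mult_left_iff coprime_commute)
      next
        case False
        with True have "i' = j'" by blast
        then have "p dvd (i - j) * (s + j')" using c by (simp add: cong_iff_dvd_diff)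
        then show ?thesis using \<open>i' = j'\<close> z0 rng cop[OF mem(4)] by (simp add: coprime_dvd_mult_left_iff coprime_commute)
      qed
      then show ?thesis using mem zz by auto
    next
      case False
      then have "?g z \<in> ratio_quads p s (L - 1) E" using c mem rng by (auto simp: zz ratio_quads_def)
      then show ?thesis using z by blast
    qed
  qed
  then have "card Z \<le> card (?D \<union> {z \<in> Z. ?g z \<in> ratio_quads p s (L - 1) E})"
    using fin finZ by (intro card_mono) auto
  also have "\<dots> \<le> card ?D + card {z \<in> Z. ?g z \<in> ratio_quads p s (L - 1) E}" by (rule card_Un_le)
  also have "card {z \<in> Z. ?g z \<in> ratio_quads p s (L - 1) E} \<le> card (ratio_quads p s (L - 1) E)"
    using fin by (intro card_inj_on_le[of ?g]) (auto intro!: inj_onI finite_ratio_quads)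
  also have "card ?D \<le> nat L * nat L"
  proof -
    have "card ?D \<le> card (E \<times> E)" using fin by (intro card_image_le) auto
    also have "\<dots> \<le> card ({0..<L} \<times> {0..<L})" using E by (intro card_mono) auto
    finally show ?thesis by (simp add: card_cartesian_product)
  qed
  finally have "real (card Z) \<le> real (nat L * nat L + card (ratio_quads p s (L - 1) E))" by linarith
  also have "\<dots> = (real_of_int L)\<^sup>2 + real (card (ratio_quads p s (L - 1) E))" using L by (simp add: power2_eq_square)
  finally have "real (card Z) * real (card Q) \<le> ((real_of_int L)\<^sup>2 + real (card (ratio_quads p s (L - 1) E))) * real (card Q)"
    by (intro mult_right_mono) auto
  with cs show ?thesis by (simp add: mult.commute)
qed

text \<open>
  Insert the divisor bound into the energy estimate. The divisors that occur are those of numbers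
  up to \<open>L\<^sup>2\<close>, so the loss is a power of \<open>L\<close> and not of \<open>p\<close>; this matters when the
  orbit is much shorter than any power of \<open>p\<close>.
\<close>

lemma ratio_set_bound_energy:
  fixes p s L :: int and E Q :: "int set" and C :: real
  assumes p: "p > 0" and L: "L \<ge> 1" "2 * (L - 1) < p" and E: "E \<subseteq> {0..<L}"
    and cop: "\<And>i. i \<in> E \<Longrightarrow> coprime (s + i) p" and Q: "finite Q"
    and ratio: "\<And>i j. i \<in> E \<Longrightarrow> j \<in> E \<Longrightarrow> \<exists>q\<in>Q. [s + i = q * (s + j)] (mod p)"
    and C: "C \<ge> 1" "\<And>n::nat. n > 0 \<Longrightarrow> real (card {d. d dvd n}) \<le> C * real n powr (1/12)"
  shows "real (card E) ^ 4 \<le> 11 * C * real (card Q) * (real_of_int L)\<^sup>2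
           * (2 * (real_of_int L)\<^sup>2 / p + 1) * real_of_int L powr (1/6)"
proof -
  define l where "l = real_of_int L"
  define \<tau> where "\<tau> = C * l powr (1/6)"
  define B where "B = 2 * l\<^sup>2 / p + 1"
  let ?F = "real (card (ratio_quads p s (L - 1) E))"
  have l: "l \<ge> 1" using L by (simp add: l_def)
  have "1 * 1 \<le> C * l powr (1/6)" using C(1) l by (intro mult_mono ge_one_powr_ge_zero) auto
  then have \<tau>: "\<tau> \<ge> 1" by (simp only: \<tau>_def mult_1)
  have B: "B \<ge> 1" using p by (simp add: B_def)
  have l2: "(l - 1) * l \<le> l\<^sup>2" using l by (simp add: power2_eq_square algebra_simps)
  have div: "real (card {d. d dvd n}) \<le> \<tau>" if "0 < n" "n \<le> nat ((L - 1) * L)" for n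
  proof -
    have "real n \<le> real (nat ((L - 1) * L))" using that(2) by (rule of_nat_mono)
    also have "\<dots> = (l - 1) * l" using L by (simp add: l_def)
    finally have "real n powr (1/12) \<le> (l\<^sup>2) powr (1/12)" using l2 by (intro powr_mono2) auto
    also have "\<dots> = l powr (1/6)" using l by (simp add: powr_powr flip: powr_numeral)
    finally have "C * real n powr (1/12) \<le> \<tau>" unfolding \<tau>_def using C by (intro mult_left_mono) auto
    then show ?thesis using C(2)[OF that(1)] by linarith
  qed
  have "?F \<le> 2 * (L - 1) * L + (4 * (L - 1) + 1) * L * (2 * (L - 1) * L / p + 1) * (2 * \<tau>)"
    using p L E cop div \<tau> by (intro card_ratio_quads_le) auto
  also have "\<dots> = 2 * ((l - 1) * l) + ((4 * l - 3) * l) * (2 * ((l - 1) * l) / p + 1) * (2 * \<tau>)"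
    by (simp add: l_def algebra_simps)
  also have "\<dots> \<le> 2 * l\<^sup>2 + (4 * l\<^sup>2) * B * (2 * \<tau>)"
  proof (rule add_mono)
    show "2 * ((l - 1) * l) \<le> 2 * l\<^sup>2" using l2 by simp
    have "2 * ((l - 1) * l) / p \<le> 2 * l\<^sup>2 / p" using l2 p by (intro divide_right_mono) auto
    then have 1: "2 * ((l - 1) * l) / p + 1 \<le> B" by (simp add: B_def)
    have 2: "(4 * l - 3) * l \<le> 4 * l\<^sup>2" using l by (simp add: power2_eq_square algebra_simps)
    have "((4 * l - 3) * l) * (2 * ((l - 1) * l) / p + 1) \<le> (4 * l\<^sup>2) * B"
      by (rule mult_mono[OF 2 1]) (use l p in auto)
    then show "((4 * l - 3) * l) * (2 * ((l - 1) * l) / p + 1) * (2 * \<tau>) \<le> (4 * l\<^sup>2) * B * (2 * \<tau>)"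
      using \<tau> by (intro mult_right_mono) auto
  qed
  finally have F: "?F \<le> 2 * l\<^sup>2 + 8 * (l\<^sup>2 * (B * \<tau>))" by (simp add: algebra_simps)
  have "l\<^sup>2 * (1 * 1) \<le> l\<^sup>2 * (B * \<tau>)" using B \<tau> by (intro mult_left_mono mult_mono) auto
  with F have F': "l\<^sup>2 + ?F \<le> 11 * (l\<^sup>2 * (B * \<tau>))" by simp
  have "real (card E) ^ 4 \<le> real (card Q) * (l\<^sup>2 + ?F)"
    unfolding l_def using p L E cop Q ratio by (intro card_ratio_set_ge_energy) auto
  also have "\<dots> \<le> real (card Q) * (11 * (l\<^sup>2 * (B * \<tau>)))" using F' by (intro mult_left_mono) auto
  finally show ?thesis by (simp add: \<tau>_def B_def l_def mult_ac)
qed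

text \<open>
  The kernel is used at the length \<open>H \<approx> p / (6 * L)\<close>, the largest one for which it still majorises the
  interval. There \<open>H * L\<close> is about \<open>p\<close>, and the number of coincidences is at most \<open>p\<close> up to the divisor
  function. The two alternatives say which of the two terms of the Fourier estimate dominates.
\<close>

lemma ratio_set_bound_fourier:
  fixes p s L :: int and E Q :: "int set" and C :: real
  assumes p: "p > 0" and L: "L \<ge> 1" "6 * L \<le> p" and E: "E \<subseteq> {0..<L}"
    and cop: "\<And>i. i \<in> E \<Longrightarrow> coprime (s + i) p" and Q: "Q \<subseteq> {0..<p}"
    and ratio: "\<And>i j. i \<in> E \<Longrightarrow> j \<in> E \<Longrightarrow> \<exists>q\<in>Q. [s + i = q * (s + j)] (mod p)"
    and C: "C \<ge> 1" "\<And>n::nat. n > 0 \<Longrightarrow> real (card {d. d dvd n}) \<le> C * real n powr (1/12)"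
  shows "real (card E) * real_of_int p \<le> 96 * real_of_int L * real (card Q) \<or>
         real (card E) ^ 4 \<le> 27648 * C * (real_of_int L)\<^sup>2 * real (card Q) * real_of_int p powr (1/12)"
proof -
  define H where "H = p div (6 * L)"
  define l h P x K where "l = real_of_int L" and "h = real_of_int H" and "P = real_of_int p"
    and "x = real (card E)" and "K = real (card Q)"
  define \<tau> where "\<tau> = C * P powr (1/12)"
  let ?F = "real (card (ratio_quads p s (H - 1) E))"
  have l: "l \<ge> 1" and P: "P \<ge> 1" using L p by (auto simp: l_def P_def)
  have "1 * 1 \<le> C * P powr (1/12)" using C(1) P by (intro mult_mono ge_one_powr_ge_zero) auto
  then have \<tau>: "\<tau> \<ge> 1" by (simp only: \<tau>_def mult_1)
  have H1: "H \<ge> 1" using L p by (simp add: H_def pos_imp_zdiv_pos_iff zdiv_mono1 int_one_le_iff_zero_less)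
  have "H * (6 * L) + p mod (6 * L) = p" unfolding H_def by (rule div_mult_mod_eq)
  moreover have "0 \<le> p mod (6 * L)" "p mod (6 * L) < 6 * L" using L by simp_all
  moreover have "6 * H * L = H * (6 * L)" "6 * L * (H + 1) = H * (6 * L) + 6 * L" by (simp_all add: algebra_simps)
  ultimately have HLle: "6 * H * L \<le> p" and less: "p < 6 * L * (H + 1)" by linarith+
  have "6 * L * (H + 1) \<le> 6 * L * (2 * H)" using L H1 by (intro mult_left_mono) auto
  with less have "p \<le> 6 * L * (2 * H)" by linarith
  then have "p \<le> 12 * (L * H)" by simp
  then have "real_of_int p \<le> real_of_int (12 * (L * H))" by (simp only: of_int_le_iff)
  then have Ple: "P \<le> 12 * (l * h)" by (simp add: P_def l_def h_def)
  have "real_of_int (6 * H * L) \<le> real_of_int p" using HLle by (simp only: of_int_le_iff)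
  then have hl: "6 * (h * l) \<le> P" by (simp add: P_def l_def h_def)
  have h: "h \<ge> 1" using H1 by (simp add: h_def)
  have hl1: "(h - 1) * l \<le> h * l" using l by (simp add: algebra_simps)
  have div: "real (card {d. d dvd n}) \<le> \<tau>" if "0 < n" "n \<le> nat ((H - 1) * L)" for n
  proof -
    have "real n \<le> real (nat ((H - 1) * L))" using that(2) by (rule of_nat_mono)
    also have "\<dots> = (h - 1) * l" using L H1 by (simp add: l_def h_def)
    also have "\<dots> \<le> P" using hl1 hl h l by (smt (verit) mult_nonneg_nonneg)
    finally have "real n powr (1/12) \<le> P powr (1/12)" by (intro powr_mono2) auto
    then have "C * real n powr (1/12) \<le> \<tau>" unfolding \<tau>_def using C by (intro mult_left_mono) auto
    then show ?thesis using C(2)[OF that(1)] by linarith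
  qed
  have F: "?F \<le> 3 * P * \<tau>"
  proof -
    have "1 * L \<le> H * L" using L H1 by (intro mult_right_mono) auto
    then have "2 * H \<le> 6 * H * L \<and> 2 * (H - 1) < 2 * H" using L H1 mult_left_mono[of 1 L "6 * H"] by simp
    then have "2 * (H - 1) < p" using HLle by linarith
    then have "?F \<le> 2 * (H - 1) * L + (4 * (H - 1) + 1) * L * (2 * (H - 1) * L / p + 1) * (2 * \<tau>)"
      using p L H1 E cop div \<tau> by (intro card_ratio_quads_le) auto
    also have "\<dots> = 2 * ((h - 1) * l) + ((4 * h - 3) * l) * (2 * ((h - 1) * l) / P + 1) * (2 * \<tau>)"
      by (simp add: l_def h_def P_def algebra_simps)
    also have "\<dots> \<le> P / 3 + (2 * P / 3) * (4 / 3) * (2 * \<tau>)"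
    proof (rule add_mono)
      show le: "2 * ((h - 1) * l) \<le> P / 3" using hl1 hl by linarith
      then have 1: "2 * ((h - 1) * l) / P + 1 \<le> 4 / 3" using P by (simp add: field_simps)
      have "(4 * h - 3) * l \<le> 4 * (h * l)" using l by (simp add: algebra_simps)
      then have 2: "(4 * h - 3) * l \<le> 2 * P / 3" using hl by linarith
      have "((4 * h - 3) * l) * (2 * ((h - 1) * l) / P + 1) \<le> (2 * P / 3) * (4 / 3)"
        by (rule mult_mono[OF 2 1]) (use h l P in auto)
      then show "((4 * h - 3) * l) * (2 * ((h - 1) * l) / P + 1) * (2 * \<tau>) \<le> (2 * P / 3) * (4 / 3) * (2 * \<tau>)"
        using \<tau> by (intro mult_right_mono) auto
    qed
    also have "\<dots> = P / 3 + 16 / 9 * (P * \<tau>)" by simp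
    also have "\<dots> \<le> 3 * P * \<tau>"
    proof -
      have "P * 1 \<le> P * \<tau>" using P \<tau> by (intro mult_left_mono) auto
      then show ?thesis unfolding mult.assoc using P \<tau> by linarith
    qed
    finally show ?thesis .
  qed
  define R where "R = sqrt (3 * P\<^sup>2 * K * \<tau>)"
  have K: "K \<ge> 0" and x: "x \<ge> 0" by (simp_all add: K_def x_def)
  have R: "R \<ge> 0" "R\<^sup>2 = 3 * P\<^sup>2 * K * \<tau>" using K \<tau> by (auto simp: R_def)
  have "sqrt (P * K * ?F) \<le> R"
  proof -
    have "P * K * ?F \<le> P * K * (3 * P * \<tau>)" using F P K by (intro mult_left_mono) auto
    also have "\<dots> = 3 * P\<^sup>2 * K * \<tau>" by (simp add: power2_eq_square mult_ac)
    finally show ?thesis by (simp add: R_def)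
  qed
  moreover have "h * x\<^sup>2 \<le> 4 * (x * K + sqrt (P * K * ?F))"
    unfolding h_def x_def P_def K_def using p H1 HLle E Q ratio by (intro card_ratio_set_ge_fourier) auto
  ultimately have main: "h * x\<^sup>2 \<le> 4 * (x * K) + 4 * R" by (simp add: algebra_simps)
  have Px: "P * x\<^sup>2 \<le> 12 * l * (h * x\<^sup>2)"
    using mult_right_mono[OF Ple, of "x\<^sup>2"] by (simp add: mult_ac)
  show ?thesis
  proof (cases "R \<le> x * K")
    case True
    then have "h * x\<^sup>2 \<le> 8 * (x * K)" using main by linarith
    then have "12 * l * (h * x\<^sup>2) \<le> 12 * l * (8 * (x * K))" using l by (intro mult_left_mono) auto
    with Px have "P * x\<^sup>2 \<le> 12 * l * (8 * (x * K))" by (rule order.trans)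
    then have "x * (x * P) \<le> x * (96 * l * K)" by (simp add: power2_eq_square mult_ac)
    then have "x * P \<le> 96 * l * K" using x l K by (cases "x = 0") auto
    then show ?thesis by (simp add: l_def P_def x_def K_def)
  next
    case False
    then have "h * x\<^sup>2 \<le> 8 * R" using main by linarith
    then have "12 * l * (h * x\<^sup>2) \<le> 12 * l * (8 * R)" using l by (intro mult_left_mono) auto
    with Px have "P * x\<^sup>2 \<le> 12 * l * (8 * R)" by (rule order.trans)
    then have "P * x\<^sup>2 \<le> 96 * l * R" by simp
    then have "(P * x\<^sup>2)\<^sup>2 \<le> (96 * l * R)\<^sup>2" using P by (intro power_mono) auto
    also have "(96 * l * R)\<^sup>2 = 9216 * l\<^sup>2 * R\<^sup>2" by (simp add: power_mult_distrib)
    also have "\<dots> = P\<^sup>2 * (27648 * l\<^sup>2 * K * \<tau>)" by (simp add: R)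
    also have "(P * x\<^sup>2)\<^sup>2 = P\<^sup>2 * x ^ 4" by (simp add: power_mult_distrib)
    finally have "x ^ 4 \<le> 27648 * l\<^sup>2 * K * \<tau>" using P by (simp add: mult_le_cancel_left_pos)
    then show ?thesis by (simp add: l_def P_def x_def K_def \<tau>_def mult_ac)
  qed
qed

section \<open>Iterated exponentiation\<close>

text \<open>
  If \<open>u i = u j\<close> with \<open>i < j\<close>, then from \<open>i\<close> on the sequence repeats with step \<open>j - i\<close>, so the least
  period is at most \<open>j - i\<close>. Walking far enough along the repetition shows that the least period
  is already effective at \<open>i\<close>, hence the preperiod is at most \<open>i\<close>, and \<open>j\<close> lies beyond the trajectory.
\<close>

lemma inj_on_trajectory:
  fixes u :: "nat \<Rightarrow> 'a"
  assumes step: "\<And>m n. u m = u n \<Longrightarrow> u (Suc m) = u (Suc n)"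
  shows "inj_on u {0..<trajectory_length u}"
proof -
  have "j \<ge> trajectory_length u" if ij: "i < j" "u i = u j" for i j
  proof -
    define d where "d = j - i"
    have d: "d \<ge> 1" "j = i + d" using ij by (auto simp: d_def)
    have per: "u n = u (n + d)" if "n \<ge> i" for n
      using that
    proof (induction n rule: dec_induct)
      case base
      show ?case using ij(2) d(2) by simp
    next
      case (step n)
      then show ?case using assms[of n "n + d"] by simp
    qed
    have per_mult: "u n = u (n + m * d)" if "n \<ge> i" for n m
    proof (induction m)
      case (Suc m)
      then show ?case using per[of "n + m * d"] that by (simp add: add_ac)
    qed simp
    let ?P = "\<lambda>t. t \<ge> 1 \<and> (\<exists>s. \<forall>n\<ge>s. u n = u (n + t))"
    have Pd: "?P d" using d per by blast
    have "?P (period u)" unfolding period_def by (rule LeastI[of ?P, OF Pd])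
    then obtain s where s: "\<forall>n\<ge>s. u n = u (n + period u)" by blast
    have "period u \<le> d" unfolding period_def by (rule Least_le[of ?P, OF Pd])
    moreover have "preperiod u \<le> i" unfolding preperiod_def
    proof (rule Least_le, intro allI impI)
      fix n assume n: "n \<ge> i"
      have "s * 1 \<le> s * d" using d by (intro mult_left_mono) auto
      then have "n + s * d \<ge> s" by linarith
      then have "u (n + s * d) = u (n + s * d + period u)" using s by blast
      also have "n + s * d + period u = n + period u + s * d" by simp
      also have "u \<dots> = u (n + period u)" using n per_mult[of "n + period u" s] by simp
      finally show "u n = u (n + period u)" using per_mult[OF n] by simp
    qed
    ultimately show ?thesis using d by (simp add: trajectory_length_def)
  qed
  then show ?thesis by (intro linorder_inj_onI) (fastforce simp: not_le[symmetric])+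
qed

lemma exp_seq_range:
  assumes "exp_seq p g u0 u" "u0 \<in> {1..p - 1}"
  shows "u n \<in> {1..p - 1}"
  using assms by (cases n) (auto simp: exp_seq_def)

lemma exp_seq_Suc_eq:
  assumes u: "exp_seq p g u0 u"
  shows "int (u (Suc n)) = g ^ u n mod int p"
proof -
  have "[int (u (Suc n)) = g ^ u n] (mod int p)" and r: "u (Suc n) \<in> {1..p - 1}"
    using u by (auto simp: exp_seq_def)
  then have "int (u (Suc n)) mod int p = g ^ u n mod int p" by (simp add: cong_def)
  moreover have "int (u (Suc n)) < int p" using r by auto
  ultimately show ?thesis by simp
qed

lemma exp_seq_inj_on_trajectory:
  assumes "exp_seq p g u0 u"
  shows "inj_on u {0..<trajectory_length u}"
proof (rule inj_on_trajectory)
  fix m n assume "u m = u n"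
  then have "int (u (Suc m)) = int (u (Suc n))" by (simp only: exp_seq_Suc_eq[OF assms])
  then show "u (Suc m) = u (Suc n)" by simp
qed

text \<open>
  The ratio of two powers of \<open>g\<close> depends only on the difference of the exponents; \<open>h\<close> is an inverse
  of \<open>g\<close> that serves the negative differences.
\<close>

lemma power_cong_power_of_difference:
  fixes g h p :: int
  assumes "[g * h = 1] (mod p)"
  shows "[g ^ x = (if int x - int y \<ge> 0 then g ^ nat (int x - int y) else h ^ nat (- (int x - int y))) * g ^ y] (mod p)"
proof (cases "x \<ge> y")
  case True
  then have "nat (int x - int y) = x - y" by linarith
  then show ?thesis using True by (simp flip: power_add)
next
  case False
  then have n: "nat (- (int x - int y)) = y - x" by linarith
  have "[(g * h) ^ (y - x) * g ^ x = 1 ^ (y - x) * g ^ x] (mod p)"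
    by (intro cong_mult cong_pow assms cong_refl)
  moreover have "(g * h) ^ (y - x) * g ^ x = h ^ (y - x) * g ^ y"
  proof -
    have "g ^ y = g ^ (y - x) * g ^ x" using False by (simp flip: power_add)
    then show ?thesis by (simp add: power_mult_distrib mult_ac)
  qed
  ultimately show ?thesis using False n by (simp add: cong_sym)
qed

text \<open>
  A difference of two elements of \<open>A\<close> is determined by the two low parts and the difference of the
  high parts, which takes fewer than \<open>2 * L\<close> values.
\<close>

lemma card_differences_le:
  fixes A :: "nat set" and k L :: nat
  assumes fin: "finite A" and A: "\<And>x. x \<in> A \<Longrightarrow> x div 2 ^ k < L"
  shows "card ((\<lambda>(x, y). int x - int y) ` (A \<times> A)) \<le> 2 * (card ((\<lambda>x. x mod 2 ^ k) ` A))\<^sup>2 * L"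
proof -
  let ?X = "(\<lambda>x. x mod 2 ^ k) ` A"
  let ?f = "\<lambda>(x, y, d). int x - int y + 2 ^ k * d"
  have "(\<lambda>(x, y). int x - int y) ` (A \<times> A) \<subseteq> ?f ` (?X \<times> ?X \<times> {- int L<..<int L})"
  proof
    fix z assume "z \<in> (\<lambda>(x, y). int x - int y) ` (A \<times> A)"
    then obtain x y where xy: "x \<in> A" "y \<in> A" "z = int x - int y" by auto
    have dec: "int v = int (v mod 2 ^ k) + 2 ^ k * int (v div 2 ^ k)" for v
    proof -
      have "v = v mod 2 ^ k + 2 ^ k * (v div 2 ^ k)" by simp
      then have "int v = int (v mod 2 ^ k + 2 ^ k * (v div 2 ^ k))" by (rule arg_cong)
      also have "\<dots> = int (v mod 2 ^ k) + 2 ^ k * int (v div 2 ^ k)"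
        by (simp only: of_nat_add of_nat_mult of_nat_power of_nat_numeral)
      finally show ?thesis .
    qed
    let ?t = "(x mod 2 ^ k, y mod 2 ^ k, int (x div 2 ^ k) - int (y div 2 ^ k))"
    have "z = ?f ?t" using dec[of x] dec[of y] xy(3) by (simp add: right_diff_distrib)
    moreover have "?t \<in> ?X \<times> ?X \<times> {- int L<..<int L}"
      using xy A[OF xy(1)] A[OF xy(2)] by auto
    ultimately show "z \<in> ?f ` (?X \<times> ?X \<times> {- int L<..<int L})" by (rule image_eqI)
  qed
  then have "card ((\<lambda>(x, y). int x - int y) ` (A \<times> A)) \<le> card (?f ` (?X \<times> ?X \<times> {- int L<..<int L}))"
    using fin by (intro card_mono) auto
  also have "\<dots> \<le> card (?X \<times> ?X \<times> {- int L<..<int L})" using fin by (intro card_image_le) auto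
  also have "\<dots> = card ?X * (card ?X * nat (2 * int L - 1))" by (simp add: card_cartesian_product)
  also have "\<dots> \<le> card ?X * (card ?X * (2 * L))" by (intro mult_left_mono) auto
  finally show ?thesis by (simp add: power2_eq_square mult_ac)
qed

lemma ex_large_fibre:
  assumes "finite S" "S \<noteq> {}"
  shows "\<exists>y\<in>f ` S. card S \<le> card (f ` S) * card {x \<in> S. f x = y}"
proof (rule ccontr)
  assume "\<not> ?thesis"
  then have "(\<Sum>y\<in>f ` S. card (f ` S) * card {x \<in> S. f x = y}) < (\<Sum>y\<in>f ` S. card S)"
    using assms by (intro sum_strict_mono) auto
  moreover have "(\<Sum>y\<in>f ` S. card {x \<in> S. f x = y}) = card S"
    using sum_fun_comp[of S "f ` S" f "\<lambda>_. 1::nat"] assms by simp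
  ultimately show False by (simp flip: sum_distrib_left)
qed

text \<open>
  This is where the sum-product phenomenon enters. Choose the most frequent low part among
  \<open>u 1, ..., u (N - 1)\<close>. The terms with this low part lie in an arithmetic progression of step \<open>2 ^ k\<close>,
  which multiplication by the inverse \<open>w\<close> of \<open>2 ^ k\<close> turns into an interval \<open>s, ..., s + L - 1\<close>. The ratio
  of two of them is the power of \<open>g\<close> to the difference of the two preceding terms, so there are no
  more ratios than differences. The term with index \<open>0\<close> is left out because it has no
  predecessor.
\<close>

lemma exp_seq_structure:
  fixes p N k u0 :: nat and g :: int and u :: "nat \<Rightarrow> nat"
  assumes p: "prime p" "p > 2" and g: "\<not> int p dvd g" and u: "exp_seq p g u0 u" and u0: "u0 \<in> {1..p - 1}"
    and N: "N \<ge> 2" "N \<le> trajectory_length u"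
  defines "\<nu> \<equiv> distinct_low_bits k u N" and "L \<equiv> (p - 1) div 2 ^ k + 1"
  shows "\<exists>(s :: int) E Q. E \<subseteq> {0..<int L} \<and> Q \<subseteq> {0..<int p} \<and> (\<forall>i\<in>E. coprime (s + i) (int p)) \<and>
    (\<forall>i\<in>E. \<forall>j\<in>E. \<exists>q\<in>Q. [s + i = q * (s + j)] (mod int p)) \<and>
    card Q \<le> 2 * \<nu>\<^sup>2 * L \<and> N - 1 \<le> \<nu> * card E"
proof -
  have rng: "u n \<in> {1..p - 1}" for n by (rule exp_seq_range[OF u u0])
  have inj: "inj_on u {0..<N}"
    using exp_seq_inj_on_trajectory[OF u] N by (rule_tac inj_on_subset) auto
  have prime_int: "prime (int p)" using p by simp
  have eta: "u n div 2 ^ k < L" for n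
  proof -
    have "u n \<le> p - 1" using rng[of n] by auto
    then have "u n div 2 ^ k \<le> (p - 1) div 2 ^ k" by (rule div_le_mono)
    then show ?thesis by (simp add: L_def)
  qed
  have \<nu>: "\<nu> = card ((\<lambda>x. x mod 2 ^ k) ` u ` {0..<N})"
    by (simp add: \<nu>_def distinct_low_bits_def low_bits_def image_image)
  have "{1..<N} \<noteq> {}" using N by simp
  then obtain \<xi> where \<xi>: "card {1..<N} \<le> card (low_bits k u ` {1..<N}) * card {n \<in> {1..<N}. low_bits k u n = \<xi>}"
    using ex_large_fibre[of "{1..<N}" "low_bits k u"] by blast
  define C where "C = {n \<in> {1..<N}. low_bits k u n = \<xi>}"
  define E where "E = (\<lambda>n. int (u n div 2 ^ k)) ` C"
  have decomp: "int (u n) = int \<xi> + 2 ^ k * int (u n div 2 ^ k)" if "n \<in> C" for n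
  proof -
    have "u n = \<xi> + 2 ^ k * (u n div 2 ^ k)" using that by (auto simp: C_def low_bits_def)
    then have "int (u n) = int (\<xi> + 2 ^ k * (u n div 2 ^ k))" by (rule arg_cong)
    then show ?thesis by simp
  qed
  have "inj_on (\<lambda>n. int (u n div 2 ^ k)) C"
  proof (rule inj_onI)
    fix m n assume mn: "m \<in> C" "n \<in> C" "int (u m div 2 ^ k) = int (u n div 2 ^ k)"
    then have "int (u m) = int (u n)" by (simp only: decomp)
    moreover have "m \<in> {0..<N}" "n \<in> {0..<N}" using mn by (auto simp: C_def)
    ultimately show "m = n" using inj by (simp add: inj_on_eq_iff)
  qed
  then have cardE: "card E = card C" by (simp add: E_def card_image)
  have "N - 1 \<le> \<nu> * card E"
  proof -
    have "N - 1 \<le> card (low_bits k u ` {1..<N}) * card C" using \<xi> by (simp add: C_def)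
    also have "\<dots> \<le> \<nu> * card C"
      unfolding \<nu>_def distinct_low_bits_def by (intro mult_right_mono card_mono image_mono) auto
    finally show ?thesis by (simp add: cardE)
  qed
  have "odd p" using p by (simp add: prime_odd_nat)
  then have "coprime (2 ^ k) (int p)" by simp
  then obtain w where w: "[2 ^ k * w = 1] (mod int p)" using cong_solve_coprime_int by blast
  have "\<not> int p dvd w"
  proof
    assume "int p dvd w"
    then have "[2 ^ k * w = 0] (mod int p)" by (simp add: cong_0_iff)
    with w have "[1 = 0] (mod int p)" by (metis cong_sym cong_trans)
    then show False using p by (simp add: cong_0_iff)
  qed
  have coprime_g: "coprime g (int p)" using prime_imp_coprime[OF prime_int g] coprime_commute by blast
  then obtain h where h: "[g * h = 1] (mod int p)" using cong_solve_coprime_int by blast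
  define s where "s = w * int \<xi>"
  define e where "e = (\<lambda>d::int. (if d \<ge> 0 then g ^ nat d else h ^ nat (- d)) mod int p)"
  define D where "D = (\<lambda>(x, y). int x - int y) ` (u ` {0..<N} \<times> u ` {0..<N})"
  have scaled: "[s + int (u n div 2 ^ k) = w * int (u n)] (mod int p)" if "n \<in> C" for n
  proof -
    have "[w * int \<xi> + 1 * int (u n div 2 ^ k) = w * int \<xi> + 2 ^ k * w * int (u n div 2 ^ k)] (mod int p)"
      by (intro cong_add cong_mult cong_refl cong_sym[OF w])
    then show ?thesis using decomp[OF that] by (simp add: s_def algebra_simps)
  qed
  show ?thesis
  proof (rule exI[of _ s], rule exI[of _ E], rule exI[of _ "e ` D"], intro conjI ballI)
    show "E \<subseteq> {0..<int L}" using eta by (auto simp: E_def simp flip: of_nat_power)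
    show "e ` D \<subseteq> {0..<int p}" using p by (auto simp: e_def)
    show "N - 1 \<le> \<nu> * card E" by fact
    show "card (e ` D) \<le> 2 * \<nu>\<^sup>2 * L"
    proof -
      have "card (e ` D) \<le> card D" by (intro card_image_le) (simp add: D_def)
      also have "\<dots> \<le> 2 * \<nu>\<^sup>2 * L" unfolding D_def \<nu> using eta by (intro card_differences_le) auto
      finally show ?thesis .
    qed
  next
    fix i assume "i \<in> E"
    then obtain m where m: "m \<in> C" "i = int (u m div 2 ^ k)" by (auto simp: E_def)
    show "coprime (s + i) (int p)"
    proof -
      have "u m > 0" "u m < p" using rng[of m] by auto
      then have "\<not> int p dvd int (u m)" by (auto dest: nat_dvd_not_less)
      with \<open>\<not> int p dvd w\<close> have "\<not> int p dvd w * int (u m)" using prime_int by (simp add: prime_dvd_mult_iff)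
      then have "\<not> int p dvd s + i" using scaled[OF m(1)] m(2) by (metis cong_dvd_iff)
      then show ?thesis using prime_imp_coprime[OF prime_int] coprime_commute by blast
    qed
  next
    fix i j assume "i \<in> E" "j \<in> E"
    then obtain m n where m: "m \<in> C" "i = int (u m div 2 ^ k)" and n: "n \<in> C" "j = int (u n div 2 ^ k)" by (auto simp: E_def)
    obtain m' n' where Suc: "m = Suc m'" "n = Suc n'" "m' < N" "n' < N"
      using m n by (cases m; cases n) (auto simp: C_def)
    define q where "q = e (int (u m') - int (u n'))"
    have "[g ^ u m' = q * g ^ u n'] (mod int p)"
      using power_cong_power_of_difference[OF h, of "u m'" "u n'"]
      by (simp add: q_def e_def cong_def mod_mult_left_eq)
    then have "[int (u m) = q * int (u n)] (mod int p)"
      by (simp add: Suc exp_seq_Suc_eq[OF u] cong_def mod_mult_right_eq)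
    then have "[w * int (u m) = w * (q * int (u n))] (mod int p)" by (rule cong_scalar_left)
    also have "w * (q * int (u n)) = q * (w * int (u n))" by (simp add: mult_ac)
    also have "[\<dots> = q * (s + j)] (mod int p)"
      using scaled[OF n(1)] n(2) by (intro cong_scalar_left) (simp add: cong_sym)
    finally have "[s + i = q * (s + j)] (mod int p)"
      using scaled[OF m(1)] m(2) by (metis cong_trans)
    moreover have "q \<in> e ` D" unfolding q_def D_def using Suc by force
    ultimately show "\<exists>q\<in>e ` D. [s + i = q * (s + j)] (mod int p)" by blast
  qed
qed

lemma exp_seq_length_less:
  assumes u: "exp_seq p g u0 u" "u0 \<in> {1..p - 1}" and N: "N \<le> trajectory_length u"
  shows "N \<le> p - 1"
proof -
  have "inj_on u {0..<N}"
    using N by (intro inj_on_subset[OF exp_seq_inj_on_trajectory[OF u(1)]]) auto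
  moreover have "u ` {0..<N} \<subseteq> {1..p - 1}" using exp_seq_range[OF u] by blast
  ultimately have "card {0..<N} \<le> card {1..p - 1}" by (intro card_inj_on_le) auto
  then show ?thesis by simp
qed

text \<open>
  Both estimates for the number of ratios, rewritten in terms of \<open>\<nu>\<^sup>2 * l\<close>. A set with
  about \<open>N / \<nu>\<close> elements has at most \<open>2 * \<nu>\<^sup>2 * l\<close> ratios, and the fourth power of \<open>N / \<nu>\<close> together with the
  factor \<open>l\<^sup>2\<close> combines with this to exactly the cube of \<open>\<nu>\<^sup>2 * l\<close>.
\<close>

lemma exp_seq_size_bounds:
  fixes p N k u0 :: nat and g :: int and u :: "nat \<Rightarrow> nat" and C :: real
  assumes p: "prime p" and g: "\<not> int p dvd g" and u: "exp_seq p g u0 u" and u0: "u0 \<in> {1..p - 1}"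
    and N: "N \<ge> 2" "N \<le> trajectory_length u" and k: "k \<ge> 1"
    and C: "C \<ge> 1" "\<And>n::nat. n > 0 \<Longrightarrow> real (card {d. d dvd n}) \<le> C * real n powr (1/12)"
  defines "\<nu> \<equiv> real (distinct_low_bits k u N)" and "l \<equiv> real ((p - 1) div 2 ^ k + 1)"
  shows "real N ^ 4 \<le> 352 * C * (\<nu>\<^sup>2 * l) ^ 3 * (2 * l\<^sup>2 / p + 1) * l powr (1/6)"
    and "real p < 6 * l \<or> real N * p \<le> 384 * (\<nu>\<^sup>2 * l)\<^sup>2 \<or>
         real N ^ 4 \<le> 884736 * C * (\<nu>\<^sup>2 * l) ^ 3 * real p powr (1/12)"
proof -
  let ?L = "(p - 1) div 2 ^ k + 1"
  have "p > 2" using exp_seq_length_less[OF u u0 N(2)] N(1) by linarith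
  obtain E Q s where E: "E \<subseteq> {0..<int ?L}" and Q: "Q \<subseteq> {0..<int p}"
    and cop: "\<And>i. i \<in> E \<Longrightarrow> coprime (s + i) (int p)"
    and ratio: "\<And>i j. i \<in> E \<Longrightarrow> j \<in> E \<Longrightarrow> \<exists>q\<in>Q. [s + i = q * (s + j)] (mod int p)"
    and cardQ: "card Q \<le> 2 * (distinct_low_bits k u N)\<^sup>2 * ?L"
    and cardE: "N - 1 \<le> distinct_low_bits k u N * card E"
    using exp_seq_structure[OF p \<open>p > 2\<close> g u u0 N, of k] by blast
  have finQ: "finite Q" using Q finite_subset by blast
  define x K where "x = real (card E)" and "K = real (card Q)"
  have x0: "x \<ge> 0" and K0: "K \<ge> 0" by (simp_all add: x_def K_def)
  have l: "l \<ge> 1" by (simp add: l_def)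
  have lL: "real_of_int (int ?L) = l" by (simp only: l_def of_int_of_nat_eq)
  have "{0..<N} \<noteq> {}" using N by auto
  then have "distinct_low_bits k u N > 0" by (auto simp: distinct_low_bits_def card_gt_0_iff)
  then have \<nu>: "\<nu> \<ge> 1" by (simp add: \<nu>_def)
  have K: "K \<le> 2 * \<nu>\<^sup>2 * l"
  proof -
    have "real (card Q) \<le> real (2 * (distinct_low_bits k u N)\<^sup>2 * ?L)" using cardQ by (rule of_nat_mono)
    also have "\<dots> = 2 * \<nu>\<^sup>2 * l" unfolding \<nu>_def l_def by (simp only: of_nat_mult of_nat_power of_nat_numeral)
    finally show ?thesis by (simp add: K_def)
  qed
  have Nx: "real N \<le> 2 * (\<nu> * x)"
  proof -
    have "N \<le> 2 * (N - 1)" using N by simp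
    also have "\<dots> \<le> 2 * (distinct_low_bits k u N * card E)" using cardE by simp
    finally have "real N \<le> real (2 * (distinct_low_bits k u N * card E))" by (rule of_nat_mono)
    then show ?thesis by (simp add: \<nu>_def x_def)
  qed
  \<comment> \<open>Both bounds for \<open>x ^ 4\<close> have this shape, with different \<open>W\<close>.\<close>
  have N4: "real N ^ 4 \<le> 352 * C * (\<nu>\<^sup>2 * l) ^ 3 * W"
    if "x ^ 4 \<le> 11 * C * K * l\<^sup>2 * W" "W \<ge> 0" for W
  proof -
    have "real N ^ 4 \<le> (2 * (\<nu> * x)) ^ 4" using Nx by (intro power_mono) auto
    also have "\<dots> = 16 * \<nu> ^ 4 * x ^ 4" by (simp add: power_mult_distrib)
    also have "\<dots> \<le> 16 * \<nu> ^ 4 * (11 * C * K * l\<^sup>2 * W)" using that by (intro mult_left_mono) auto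
    also have "\<dots> = 176 * C * \<nu> ^ 4 * l\<^sup>2 * W * K" by simp
    also have "\<dots> \<le> 176 * C * \<nu> ^ 4 * l\<^sup>2 * W * (2 * \<nu>\<^sup>2 * l)" using K C that l by (intro mult_left_mono) auto
    also have "\<dots> = 352 * C * (\<nu>\<^sup>2 * l) ^ 3 * W"
      by (simp add: power_mult_distrib flip: power_mult) (simp add: eval_nat_numeral)
    finally show ?thesis .
  qed
  have "2 * ((p - 1) div 2 ^ k) \<le> p - 1"
  proof -
    have "2 * ((p - 1) div 2 ^ k) \<le> 2 ^ k * ((p - 1) div 2 ^ k)"
      using power_increasing[OF k, of "2::nat"] by (intro mult_right_mono) auto
    then show ?thesis using times_div_less_eq_dividend[of "2 ^ k" "p - 1"] by linarith
  qed
  then have "2 * ((p - 1) div 2 ^ k) < p" using \<open>p > 2\<close> by linarith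
  then have "int (2 * ((p - 1) div 2 ^ k)) < int p" by (simp only: of_nat_less_iff)
  then have L2: "2 * (int ?L - 1) < int p" by (simp only: of_nat_mult of_nat_add of_nat_1 of_nat_numeral add_diff_cancel_right')
  have L1: "int ?L \<ge> 1" by simp
  have pp: "int p > 0" using \<open>p > 2\<close> by simp
  have "x ^ 4 \<le> 11 * C * K * l\<^sup>2 * (2 * l\<^sup>2 / p + 1) * l powr (1/6)"
    using ratio_set_bound_energy[OF pp L1 L2 E cop finQ ratio C] unfolding lL x_def K_def by simp
  then show "real N ^ 4 \<le> 352 * C * (\<nu>\<^sup>2 * l) ^ 3 * (2 * l\<^sup>2 / p + 1) * l powr (1/6)"
    using N4[of "(2 * l\<^sup>2 / p + 1) * l powr (1/6)"] by (simp add: mult.assoc)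
  show "real p < 6 * l \<or> real N * p \<le> 384 * (\<nu>\<^sup>2 * l)\<^sup>2 \<or>
         real N ^ 4 \<le> 884736 * C * (\<nu>\<^sup>2 * l) ^ 3 * real p powr (1/12)"
  proof (cases "6 * int ?L \<le> int p")
    case False
    then have "real_of_int (int p) < 6 * real_of_int (int ?L)" by linarith
    then show ?thesis unfolding lL by simp
  next
    case True
    from ratio_set_bound_fourier[OF pp L1 True E cop Q ratio C]
    have "x * p \<le> 96 * l * K \<or> x ^ 4 \<le> 27648 * C * l\<^sup>2 * K * real p powr (1/12)"
      unfolding lL x_def K_def by simp
    then show ?thesis
    proof
      assume xp: "x * p \<le> 96 * l * K"
      have "96 * l * K \<le> 96 * l * (2 * \<nu>\<^sup>2 * l)" using K l by (intro mult_left_mono) auto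
      with xp have xp': "x * p \<le> 96 * l * (2 * \<nu>\<^sup>2 * l)" by (rule order.trans)
      have "real N * p \<le> 2 * (\<nu> * x) * p" using Nx by (intro mult_right_mono) auto
      also have "\<dots> = 2 * \<nu> * (x * p)" by simp
      also have "\<dots> \<le> 2 * \<nu> * (96 * l * (2 * \<nu>\<^sup>2 * l))"
        by (rule mult_left_mono[OF xp']) (use \<nu> in simp)
      also have "\<dots> = 384 * (\<nu> ^ 3 * l\<^sup>2)" by (simp add: power2_eq_square power3_eq_cube)
      also have "\<dots> \<le> 384 * (\<nu> ^ 4 * l\<^sup>2)"
        using \<nu> by (intro mult_left_mono mult_right_mono power_increasing) auto
      also have "\<dots> = 384 * (\<nu>\<^sup>2 * l)\<^sup>2" by (simp add: power_mult_distrib flip: power_mult)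
      finally show ?thesis by blast
    next
      assume "x ^ 4 \<le> 27648 * C * l\<^sup>2 * K * real p powr (1/12)"
      then have "x ^ 4 \<le> 11 * C * K * l\<^sup>2 * (27648 / 11 * real p powr (1/12))" by (simp add: mult_ac)
      from N4[OF this] show ?thesis by (simp add: mult_ac)
    qed
  qed
qed

section \<open>Comparison of exponents\<close>

text \<open>
  The logarithm of the lower bound for \<open>\<nu>\<^sup>2 * p / 2 ^ k\<close> that the theorem asserts, for \<open>x = ln N\<close> and
  \<open>y = ln p\<close>. In logarithms the comparisons of the five ranges become linear inequalities.
\<close>

definition log_target :: "real \<Rightarrow> real \<Rightarrow> real" where
  "log_target x y =
     (if x \<le> 1/2 * y then 12/11 * x
      else if x \<le> 35/68 * y then 7/6 * x - 1/12 * y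
      else if x \<le> 13/24 * y then 10/11 * x + 2/11 * y
      else if x \<le> 2/3 * y then 2 * x - y
      else 1/2 * x + 1/2 * y)"

lemma main_term_eq_exp:
  assumes "N > 0" "p > 0"
  shows "main_term p k N = exp ((log_target (ln (real N)) (ln (real p)) + (k * ln 2 - ln (real p))) / 2)"
proof -
  define x y where "x = ln (real N)" and "y = ln (real p)"
  have exps: "real N = exp x" "real p = exp y" "(2::real) ^ k = exp (k * ln 2)"
    using assms by (auto simp: x_def y_def exp_of_nat_mult)
  show ?thesis
    unfolding main_term_def log_target_def exps
    by (auto simp: powr_def field_simps simp flip: exp_add exp_diff)
qed

text \<open>
  Above \<open>p powr (1/2)\<close> the square of the asserted bound is at most \<open>N * p\<close> and its cube at most
  \<open>N ^ 4 * p powr (-1/12)\<close>. The second inequality is tightest at \<open>N = p powr (35/68)\<close>, where the exponent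
  \<open>1/12\<close> could be replaced by any number up to \<open>41/374\<close>.
\<close>

lemma log_target_le:
  assumes "1/2 * y < x" "x \<le> y"
  shows "2 * log_target x y \<le> x + y" "3 * log_target x y \<le> 4 * x - 1/12 * y"
  using assms unfolding log_target_def by (auto split: if_splits)

text \<open>
  Here the five ranges are settled. For \<open>n \<le> p powr (1/2)\<close> one may assume that \<open>l\<close> is smaller than
  \<open>n powr (12/11)\<close>, as \<open>M \<ge> l\<close>; then \<open>l\<^sup>2 / p\<close> and \<open>l powr (1/6)\<close> are both at most \<open>n powr (2/11)\<close>, and the
  energy bound gives \<open>M ^ 3\<close> of order at least \<open>n powr (40/11)\<close>, more than the cube \<open>n powr (36/11)\<close> that is
  asked for. For larger \<open>n\<close> each of the three alternatives of the Fourier bound suffices. The constant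
  \<open>10 ^ 6\<close> exceeds all numerical factors.
\<close>

lemma size_lower_bound:
  fixes n p l M C :: real
  assumes n: "1 \<le> n" "n \<le> p" and l: "1 \<le> l" "l \<le> M" and C: "C \<ge> 1"
    and A: "n ^ 4 \<le> 352 * C * M ^ 3 * (2 * l\<^sup>2 / p + 1) * l powr (1/6)"
    and B: "p < 6 * l \<or> n * p \<le> 384 * M\<^sup>2 \<or> n ^ 4 \<le> 884736 * C * M ^ 3 * p powr (1/12)"
  shows "M \<ge> 1 / (10 ^ 6 * C) * exp (log_target (ln n) (ln p))"
proof -
  define x y \<mu> where "x = ln n" and "y = ln p" and "\<mu> = ln l"
  define t c where "t = log_target x y" and "c = 1 / (10 ^ 6 * C)"
  have exps: "n = exp x" "p = exp y" "l = exp \<mu>" using n l by (auto simp: x_def y_def \<mu>_def)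
  have xy: "0 \<le> x" "x \<le> y" using n by (auto simp: x_def y_def)
  have c: "0 < c" "c \<le> 1 / 10 ^ 6" "C * c = 1 / 10 ^ 6" using C by (auto simp: c_def field_simps)
  have M: "M \<ge> 1" using l by simp
  have cpow: "c ^ 3 \<le> c" "c\<^sup>2 \<le> c" using c power_decreasing[of 1 3 c] power_decreasing[of 1 2 c] by auto
  have cube: "c * exp t \<le> M" if "c * exp (3 * t) \<le> M ^ 3"
  proof -
    have "(c * exp t) ^ 3 = c ^ 3 * exp (3 * t)" by (simp add: power_mult_distrib flip: exp_of_nat_mult)
    also have "\<dots> \<le> c * exp (3 * t)" using cpow by (intro mult_right_mono) auto
    also have "\<dots> \<le> M ^ 3" by fact
    finally have "(c * exp t) ^ 3 \<le> M ^ 3" .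
    then show ?thesis using c M by (subst (asm) power_mono_iff) auto
  qed
  have "c * exp t \<le> M"
  proof (cases "x \<le> 1/2 * y")
    case True
    then have t: "t = 12/11 * x" by (simp add: t_def log_target_def)
    show ?thesis
    proof (cases "t \<le> \<mu>")
      case True
      then have "1 * exp t \<le> l" by (simp add: exps)
      moreover have "c * exp t \<le> 1 * exp t" using c by (intro mult_right_mono) auto
      ultimately show ?thesis using l by linarith
    next
      case False
      have "2 * l\<^sup>2 / p = 2 * exp (2 * \<mu> - y)" by (simp add: exps exp_diff flip: exp_of_nat_mult)
      also have "exp (2 * \<mu> - y) \<le> exp (2/11 * x)" using False True t by simp
      finally have "2 * l\<^sup>2 / p + 1 \<le> 3 * exp (2/11 * x)"
        using one_le_exp_iff[of "2/11 * x"] xy by linarith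
      moreover have "l powr (1/6) \<le> exp (2/11 * x)" using False t by (simp add: exps powr_def)
      ultimately have "(2 * l\<^sup>2 / p + 1) * l powr (1/6) \<le> 3 * exp (2/11 * x) * exp (2/11 * x)"
        by (intro mult_mono) auto
      also have "\<dots> = 3 * exp (4/11 * x)" by (simp flip: exp_add)
      finally have "352 * C * M ^ 3 * ((2 * l\<^sup>2 / p + 1) * l powr (1/6)) \<le> 352 * C * M ^ 3 * (3 * exp (4/11 * x))"
        using C M by (intro mult_left_mono) auto
      then have "n ^ 4 \<le> 1056 * C * M ^ 3 * exp (4/11 * x)" using A by (simp add: mult_ac)
      moreover have "n ^ 4 = exp (40/11 * x) * exp (4/11 * x)" by (simp add: exps flip: exp_of_nat_mult exp_add)
      ultimately have "exp (40/11 * x) \<le> 1056 * C * M ^ 3" by (simp add: mult_le_cancel_right)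
      moreover have "exp (3 * t) \<le> exp (40/11 * x)" using xy by (simp add: t)
      ultimately have "exp (3 * t) \<le> 1056 * C * M ^ 3" by linarith
      then have "c * exp (3 * t) \<le> c * (1056 * C * M ^ 3)" using c by (intro mult_left_mono) auto
      also have "\<dots> = 1056 * (C * c) * M ^ 3" by simp
      also have "\<dots> \<le> M ^ 3" using c M by simp
      finally show ?thesis by (rule cube)
    qed
  next
    case False
    then have t: "2 * t \<le> x + y" "3 * t \<le> 4 * x - 1/12 * y"
      using log_target_le[of y x] xy by (auto simp: t_def)
    from B consider "p < 6 * l" | "n * p \<le> 384 * M\<^sup>2" | "n ^ 4 \<le> 884736 * C * M ^ 3 * p powr (1/12)" by blast
    then show ?thesis
    proof cases
      case 1
      have "exp t \<le> p" using t xy by (simp add: exps)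
      then have "c * exp t \<le> 1 / 10 ^ 6 * p" using c n by (intro mult_mono) auto
      also have "\<dots> \<le> M" using 1 l by simp
      finally show ?thesis .
    next
      case 2
      have "(c * exp t)\<^sup>2 = c\<^sup>2 * exp (2 * t)" by (simp add: power_mult_distrib flip: exp_of_nat_mult)
      also have "\<dots> \<le> c * (n * p)" using cpow t c by (intro mult_mono) (auto simp: exps simp flip: exp_add)
      also have "\<dots> \<le> 1 / 10 ^ 6 * (384 * M\<^sup>2)" by (rule mult_mono) (use c 2 n in auto)
      also have "\<dots> \<le> M\<^sup>2" by simp
      finally have "(c * exp t)\<^sup>2 \<le> M\<^sup>2" .
      then show ?thesis by (rule power2_le_imp_le) (use M in simp)
    next
      case 3
      have "n ^ 4 = exp (4 * x - 1/12 * y) * exp (1/12 * y)" by (simp add: exps flip: exp_of_nat_mult exp_add)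
      moreover have "p powr (1/12) = exp (1/12 * y)" by (simp add: exps powr_def)
      ultimately have "exp (4 * x - 1/12 * y) \<le> 884736 * C * M ^ 3" using 3 by (simp add: mult_le_cancel_right)
      moreover have "exp (3 * t) \<le> exp (4 * x - 1/12 * y)" using t by simp
      ultimately have "exp (3 * t) \<le> 884736 * C * M ^ 3" by linarith
      then have "c * exp (3 * t) \<le> c * (884736 * C * M ^ 3)" using c by (intro mult_left_mono) auto
      also have "\<dots> = 884736 * (C * c) * M ^ 3" by simp
      also have "\<dots> \<le> M ^ 3" using c M by simp
      finally show ?thesis by (rule cube)
    qed
  qed
  then show ?thesis by (simp add: c_def t_def x_def y_def)
qed

text \<open>
  The square of the main term is \<open>2 ^ k / p\<close> times the exponential of \<open>log_target\<close>, and \<open>l \<le> 3 * p / 2 ^ k\<close>,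
  hence dividing the lower bound for \<open>\<nu>\<^sup>2 * l\<close> by \<open>l\<close> and taking square roots gives the claim.
\<close>

lemma distinct_low_bits_lower_bound:
  "\<exists>c>0. \<forall>(p::nat) (r::nat) (g::int) (u0::nat) (u::nat \<Rightarrow> nat) (k::nat) (N::nat).
     bit_prime r p \<longrightarrow> \<not> int p dvd g \<longrightarrow> u0 \<in> {1..p - 1} \<longrightarrow> exp_seq p g u0 u \<longrightarrow>
     1 \<le> k \<longrightarrow> k \<le> r \<longrightarrow> 2 \<le> N \<longrightarrow> N \<le> trajectory_length u \<longrightarrow>
     c * main_term p k N \<le> real (distinct_low_bits k u N)"
proof -
  obtain C where C: "C \<ge> 1" "\<And>n::nat. n > 0 \<Longrightarrow> real (card {d. d dvd n}) \<le> C * real n powr (1/12)"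
    using card_divisors_le_powr[of "1/12"] by auto
  define c where "c = 1 / (10 ^ 6 * C)"
  have c: "c > 0" using C by (simp add: c_def)
  show ?thesis
  proof (intro exI[of _ "sqrt (c / 3)"] conjI allI impI)
    show "sqrt (c / 3) > 0" using c by simp
    fix p r :: nat and g :: int and u0 :: nat and u :: "nat \<Rightarrow> nat" and k N :: nat
    assume bp: "bit_prime r p" and g: "\<not> int p dvd g" and u0: "u0 \<in> {1..p - 1}" and u: "exp_seq p g u0 u"
      and k: "1 \<le> k" "k \<le> r" and N: "2 \<le> N" "N \<le> trajectory_length u"
    have p: "prime p" using bp by (simp add: bit_prime_def)
    have p0: "p > 0" using p by (simp add: prime_gt_0_nat)
    define \<nu> where "\<nu> = real (distinct_low_bits k u N)"
    define l where "l = real ((p - 1) div 2 ^ k + 1)"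
    define t where "t = log_target (ln (real N)) (ln (real p))"
    have "{0..<N} \<noteq> {}" using N by auto
    then have "distinct_low_bits k u N > 0" by (auto simp: distinct_low_bits_def card_gt_0_iff)
    then have \<nu>: "\<nu> \<ge> 1" by (simp add: \<nu>_def)
    have l1: "l \<ge> 1" by (simp add: l_def)
    have "1 * l \<le> \<nu>\<^sup>2 * l" using \<nu> l1 by (intro mult_right_mono) (auto simp: one_le_power)
    moreover have "real N \<le> real p" using exp_seq_length_less[OF u u0 N(2)] by simp
    ultimately have M: "c * exp t \<le> \<nu>\<^sup>2 * l"
      using exp_seq_size_bounds[OF p g u u0 N k(1) C] N C(1) l1
      unfolding c_def t_def \<nu>_def l_def by (intro size_lower_bound) auto
    \<comment> \<open>Rounding: the \<open>+ 1\<close> in \<open>l\<close> is harmless since \<open>2 ^ k \<le> 2 ^ r \<le> 2 * p\<close>.\<close>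
    have l3: "l \<le> 3 * (real p / 2 ^ k)"
    proof -
      have "2 ^ k \<le> (2 ^ r :: nat)" using k by (intro power_increasing) auto
      also have "\<dots> = 2 * 2 ^ (r - 1)" using k by (cases r) auto
      also have "\<dots> \<le> 2 * p" using bp by (simp add: bit_prime_def)
      finally have "real (2 ^ k) \<le> real (2 * p)" by (rule of_nat_mono)
      then have "1 \<le> 2 * (real p / 2 ^ k)" by (simp add: field_simps)
      moreover have "real ((p - 1) div 2 ^ k) \<le> real (p - 1) / real (2 ^ k)" by (rule of_nat_div_le_of_nat)
      moreover have "real (p - 1) / real (2 ^ k) \<le> real p / 2 ^ k" by (simp add: divide_right_mono)
      ultimately show ?thesis unfolding l_def of_nat_add of_nat_1 by linarith
    qed
    have "c * exp t \<le> \<nu>\<^sup>2 * (3 * (real p / 2 ^ k))"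
      using M mult_left_mono[OF l3, of "\<nu>\<^sup>2"] by simp
    then have "c / 3 * (exp t * (2 ^ k / real p)) \<le> \<nu>\<^sup>2" using p0 by (simp add: field_simps)
    moreover have "(main_term p k N)\<^sup>2 = exp t * (2 ^ k / real p)"
    proof -
      have "(main_term p k N)\<^sup>2 = exp (t + (k * ln 2 - ln (real p)))"
        using N p0 by (simp add: main_term_eq_exp t_def flip: exp_of_nat_mult)
      also have "\<dots> = exp t * (exp (real k * ln 2) / exp (ln (real p)))" by (simp add: exp_add exp_diff)
      also have "exp (real k * ln 2) = 2 ^ k" by (simp add: exp_of_nat_mult)
      finally show ?thesis using p0 by simp
    qed
    ultimately have "(sqrt (c / 3) * main_term p k N)\<^sup>2 \<le> \<nu>\<^sup>2"
      using c by (simp add: power_mult_distrib)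
    then have "sqrt (c / 3) * main_term p k N \<le> \<nu>" by (rule power2_le_imp_le) (use \<nu> in simp)
    then show "sqrt (c / 3) * main_term p k N \<le> real (distinct_low_bits k u N)" by (simp add: \<nu>_def)
  qed
qed

theorem theorem8:
  "\<forall>\<epsilon>::real. \<epsilon> > 0 \<longrightarrow>
     (\<exists>N0::nat. \<forall>(p::nat) (r::nat) (g::int) (u0::nat) (u::nat \<Rightarrow> nat) (k::nat) (N::nat).
        bit_prime r p \<longrightarrow> \<not> int p dvd g \<longrightarrow> u0 \<in> {1..p - 1} \<longrightarrow> exp_seq p g u0 u \<longrightarrow>
        1 \<le> k \<longrightarrow> k \<le> r \<longrightarrow>
        0 < N \<longrightarrow> N0 \<le> N \<longrightarrow> N \<le> trajectory_length u \<longrightarrow>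
        real (distinct_low_bits k u N) \<ge> real N powr (- \<epsilon>) * main_term p k N)"
proof (intro allI impI)
  fix \<epsilon> :: real assume \<epsilon>: "\<epsilon> > 0"
  obtain c where c: "c > 0" and bound: "\<And>p r g u0 u k N. bit_prime r p \<Longrightarrow> \<not> int p dvd g \<Longrightarrow>
      u0 \<in> {1..p - 1} \<Longrightarrow> exp_seq p g u0 u \<Longrightarrow> 1 \<le> k \<Longrightarrow> k \<le> r \<Longrightarrow> 2 \<le> N \<Longrightarrow> N \<le> trajectory_length u \<Longrightarrow>
      c * main_term p k N \<le> real (distinct_low_bits k u N)"
    using distinct_low_bits_lower_bound by blast
  \<comment> \<open>From this point on \<open>N powr (- \<epsilon>)\<close> is below the constant \<open>c\<close>.\<close>
  define N0 where "N0 = max 2 (nat \<lceil>c powr (- (1 / \<epsilon>))\<rceil>)"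
  have small: "real N powr (- \<epsilon>) \<le> c" if "N \<ge> N0" for N
  proof -
    have "c powr (- (1 / \<epsilon>)) \<le> real N" using that unfolding N0_def by linarith
    then have "real N powr (- \<epsilon>) \<le> (c powr (- (1 / \<epsilon>))) powr (- \<epsilon>)"
      using c \<epsilon> by (intro powr_mono2') auto
    then show ?thesis using c \<epsilon> by (simp add: powr_powr)
  qed
  show "\<exists>N0::nat. \<forall>(p::nat) (r::nat) (g::int) (u0::nat) (u::nat \<Rightarrow> nat) (k::nat) (N::nat).
        bit_prime r p \<longrightarrow> \<not> int p dvd g \<longrightarrow> u0 \<in> {1..p - 1} \<longrightarrow> exp_seq p g u0 u \<longrightarrow>
        1 \<le> k \<longrightarrow> k \<le> r \<longrightarrow>
        0 < N \<longrightarrow> N0 \<le> N \<longrightarrow> N \<le> trajectory_length u \<longrightarrow>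
        real (distinct_low_bits k u N) \<ge> real N powr (- \<epsilon>) * main_term p k N"
  proof (intro exI[of _ N0] allI impI)
    fix p r :: nat and g :: int and u0 :: nat and u :: "nat \<Rightarrow> nat" and k N :: nat
    assume h: "bit_prime r p" "\<not> int p dvd g" "u0 \<in> {1..p - 1}" "exp_seq p g u0 u" "1 \<le> k" "k \<le> r"
      "N0 \<le> N" "N \<le> trajectory_length u"
    have "main_term p k N \<ge> 0" by (simp add: main_term_def)
    then have "real N powr (- \<epsilon>) * main_term p k N \<le> c * main_term p k N"
      using small[OF h(7)] by (intro mult_right_mono)
    also have "\<dots> \<le> real (distinct_low_bits k u N)" using h by (intro bound) (auto simp: N0_def)
    finally show "real N powr (- \<epsilon>) * main_term p k N \<le> real (distinct_low_bits k u N)" .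
  qed
qed

end
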